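(* The even symmetric form $$\tfrac{1}{18}p_{(2^5)}+3p_{(8,2)}+6p_{(6,4)}-3p_{(6,2^2)}=\tfrac1{18}p_2^5+3p_8p_2+6p_6p_4-3p_6p_2^2\in\mathbb{R}[X_1,\dots,X_n]$$ is nonnegative on $\mathbb{R}^n$ for every number of variables $n$, but there is a fixed $N\in\mathbb{N}$ such that for every $n\ge N$ it is not a sum of squares of polynomials in $\mathbb{R}[X_1,\dots,X_n]$.
   Context: $p_k=p_k(X_1,\dots,X_n)=X_1^k+\cdots+X_n^k$, and for a partition $\lambda$, $p_\lambda=\prod_i p_{\lambda_i}$; an exponent in a partition denotes repetition of a part. *)

theory Defs
  imports Complex_Main "HOL-Library.Poly_Mapping" "HOL-Combinatorics.Permutations"
begin

text \<open>
  Real polynomials in the variables X_0, X_1, X_2, ...: a monomial is a finitely supported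
  exponent vector, a polynomial a finitely supported map from monomials to coefficients. The ring
  structure is the one that Poly_Mapping provides (multiplication is convolution).
\<close>

type_synonym monom = "nat \<Rightarrow>\<^sub>0 nat"
type_synonym rpoly = "monom \<Rightarrow>\<^sub>0 real"

definition Var :: "nat \<Rightarrow> rpoly" where
  "Var i = Poly_Mapping.single (Poly_Mapping.single i 1) 1"

definition Const :: "real \<Rightarrow> rpoly" where
  "Const c = Poly_Mapping.single 0 c"

text \<open>The subring \<open>\<real>[X_1, \<dots>, X_n]\<close>; note that the variables are indexed from 1.\<close>

definition poly_ring :: "nat \<Rightarrow> rpoly set" where
  "poly_ring n = {f. \<forall>m \<in> Poly_Mapping.keys f. Poly_Mapping.keys m \<subseteq> {1..n}}"

text \<open>
  For \<open>f \<in> poly_ring n\<close> only \<open>x 1, \<dots>, x n\<close> matter, so quantifying over all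
  \<open>x :: nat \<Rightarrow> real\<close> amounts to quantifying over \<open>\<real>\<^sup>n\<close>.
\<close>

definition eval_poly :: "(nat \<Rightarrow> real) \<Rightarrow> rpoly \<Rightarrow> real" where
  "eval_poly x f = (\<Sum>m \<in> Poly_Mapping.keys f.
     Poly_Mapping.lookup f m * (\<Prod>i \<in> Poly_Mapping.keys m. x i ^ Poly_Mapping.lookup m i))"

definition nonneg_poly :: "rpoly \<Rightarrow> bool" where
  "nonneg_poly f \<longleftrightarrow> (\<forall>x. eval_poly x f \<ge> 0)"

definition sum_of_squares :: "nat \<Rightarrow> rpoly \<Rightarrow> bool" where
  "sum_of_squares n f \<longleftrightarrow> (\<exists>qs. set qs \<subseteq> poly_ring n \<and> f = (\<Sum>q\<leftarrow>qs. q ^ 2))"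

definition form_of_degree :: "nat \<Rightarrow> rpoly \<Rightarrow> bool" where
  "form_of_degree d f \<longleftrightarrow> (\<forall>m \<in> Poly_Mapping.keys f.
     (\<Sum>i \<in> Poly_Mapping.keys m. Poly_Mapping.lookup m i) = d)"

text \<open>
  \<open>Poly_Mapping.map_key \<pi> m\<close> is the exponent vector \<open>\<lambda>i. m (\<pi> i)\<close>, so this says that
  \<open>f\<close> is invariant under all permutations of \<open>X_1, \<dots>, X_n\<close>.
\<close>

definition symmetric_poly :: "nat \<Rightarrow> rpoly \<Rightarrow> bool" where
  "symmetric_poly n f \<longleftrightarrow> (\<forall>\<pi>. \<pi> permutes {1..n} \<longrightarrow>
     (\<forall>m. Poly_Mapping.lookup f (Poly_Mapping.map_key \<pi> m) = Poly_Mapping.lookup f m))"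

text \<open>Even in each variable separately.\<close>

definition even_poly :: "rpoly \<Rightarrow> bool" where
  "even_poly f \<longleftrightarrow> (\<forall>m \<in> Poly_Mapping.keys f. \<forall>i. even (Poly_Mapping.lookup m i))"

definition power_sum :: "nat \<Rightarrow> nat \<Rightarrow> rpoly" where
  "power_sum n k = (\<Sum>i = 1..n. Var i ^ k)"

text \<open>A partition is given by the list of its parts.\<close>

definition power_sum_part :: "nat \<Rightarrow> nat list \<Rightarrow> rpoly" where
  "power_sum_part n ps = (\<Prod>k\<leftarrow>ps. power_sum n k)"

definition the_form :: "nat \<Rightarrow> rpoly" where
  "the_form n =
     Const (1 / 18) * power_sum_part n (replicate 5 2)
     + Const 3 * power_sum_part n [8, 2]
     + Const 6 * power_sum_part n [6, 4]
     - Const 3 * power_sum_part n (6 # replicate 2 2)"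

end

(*
  Write p_k for the sum of the k-th powers of the squared variables y_i = X_i^2. Nonnegativity: by
  Cauchy-Schwarz p_3^2 <= p_2 p_4, which leaves a quadratic in p_2 whose discriminant has a favourable sign.

  Not a sum of squares: if the form were a sum of squares, the squared polynomials would be quintic
  forms, because extremal monomials cannot cancel. So it suffices to find a linear functional that is
  nonnegative on squares of quintic forms and negative on the form. It vanishes on monomials with an
  odd exponent and sends y_i y_j y_k y_l y_m to a sum over the set partitions of the five positions
  that are compatible with the coincidences of the indices; a partition with b blocks has weight
  proportional to h^b, where h = 1/n. The value on the form is then -1/9 + O(h). The
  functional decouples quintic forms according to the set of variables with odd exponent, which has one,
  three or five elements. For one element, quintic forms are symmetric matrices, and centering
  their row sums, diagonals and distinguished row reduces nonnegativity to that of one ternary and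
  one quaternary quadratic form, uniformly in n.
*)
theory Submission
  imports Defs "HOL-Analysis.Convex"
begin

section \<open>Linear extension of functions on monomials\<close>

text \<open>The form is invariant under permutations and sign changes of the variables, and
  averaging a functional over these keeps it nonnegative on squares. So a separating functional may
  be sought among the invariant ones: they vanish on odd exponents and are given by seven
  coefficients, one for each block type of a set partition of five positions. The scaling
  \<open>h ^ b\<close> makes the limit readable. A set partition with \<open>b\<close> blocks is met
  by \<open>n ^ b\<close> words, but in a product of power sums some positions are already tied
  together; the partition then keeps its full weight only if it is coarser than the one formed by
  these ties, and otherwise contributes O(h). The obstacle is uniformity, since the space of quintic
  forms grows with \<open>n\<close>. Sums over an index split into a part from the means and a part
  from the deviations, and after rescaling by powers of \<open>h\<close> both have coefficient
  matrices free of \<open>n\<close>. The margin 1/9 is thin compared to the coefficients, hence the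
  large threshold for \<open>n\<close>.\<close>

definition lin_ext :: "(real \<Rightarrow> 'b::comm_ring_1) \<Rightarrow> (monom \<Rightarrow> 'b) \<Rightarrow> rpoly \<Rightarrow> 'b" where
  "lin_ext \<chi> \<phi> f = (\<Sum>m \<in> Poly_Mapping.keys f. \<chi> (Poly_Mapping.lookup f m) * \<phi> m)"

text \<open>Coefficients enter through an additive \<open>\<chi>\<close>, so that one construction
  yields evaluation and the separating functional (with the identity) as well as the substitution of
  permuted variables (with \<open>Const\<close>).\<close>

locale additive_map =
  fixes \<chi> :: "real \<Rightarrow> 'b::comm_ring_1"
  assumes add: "\<chi> (a + b) = \<chi> a + \<chi> b"
begin

lemma zero: "\<chi> 0 = 0"
  using add[of 0 0] by simp

lemma lin_ext_superset:
  assumes "finite A" "Poly_Mapping.keys f \<subseteq> A"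
  shows "lin_ext \<chi> \<phi> f = (\<Sum>m\<in>A. \<chi> (Poly_Mapping.lookup f m) * \<phi> m)"
  unfolding lin_ext_def
  by (rule sum.mono_neutral_left) (use assms in \<open>auto simp: in_keys_iff zero\<close>)

lemma lin_ext_add: "lin_ext \<chi> \<phi> (f + g) = lin_ext \<chi> \<phi> f + lin_ext \<chi> \<phi> g"
proof -
  let ?A = "Poly_Mapping.keys f \<union> Poly_Mapping.keys g"
  have "Poly_Mapping.keys (f + g) \<subseteq> ?A" by (rule keys_add)
  then show ?thesis
    by (simp add: lin_ext_superset[of ?A] lookup_add add algebra_simps sum.distrib)
qed

lemma lin_ext_zero: "lin_ext \<chi> \<phi> 0 = 0"
  by (simp add: lin_ext_def)

lemma lin_ext_single: "lin_ext \<chi> \<phi> (Poly_Mapping.single m c) = \<chi> c * \<phi> m"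
  by (simp add: lin_ext_def zero)

lemma lin_ext_sum: "lin_ext \<chi> \<phi> (sum F A) = (\<Sum>a\<in>A. lin_ext \<chi> \<phi> (F a))"
  by (induction A rule: infinite_finite_induct) (auto simp: lin_ext_zero lin_ext_add)

lemma lin_ext_sum_list: "lin_ext \<chi> \<phi> (\<Sum>x\<leftarrow>xs. F x) = (\<Sum>x\<leftarrow>xs. lin_ext \<chi> \<phi> (F x))"
  by (induction xs) (auto simp: lin_ext_zero lin_ext_add)

lemma lin_ext_diff: "lin_ext \<chi> \<phi> (f - g) = lin_ext \<chi> \<phi> f - lin_ext \<chi> \<phi> g"
  using lin_ext_add[of \<phi> "f - g" g] by simp

end

lemma sum_singles: "(\<Sum>m \<in> Poly_Mapping.keys f. Poly_Mapping.single m (Poly_Mapping.lookup f m)) = f"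
  by (rule poly_mapping_eqI)
    (auto simp: lookup_sum lookup_single when_def in_keys_iff sum.delta)

lemma mult_eq_sum_singles:
  "f * g = (\<Sum>a \<in> Poly_Mapping.keys f. \<Sum>b \<in> Poly_Mapping.keys g.
     Poly_Mapping.single (a + b) (Poly_Mapping.lookup f a * Poly_Mapping.lookup g b))"
  for f g :: rpoly
proof -
  have "f * g = (\<Sum>m \<in> Poly_Mapping.keys f. Poly_Mapping.single m (Poly_Mapping.lookup f m)) *
    (\<Sum>m \<in> Poly_Mapping.keys g. Poly_Mapping.single m (Poly_Mapping.lookup g m))"
    by (simp only: sum_singles)
  then show ?thesis
    by (simp add: sum_product mult_single)
qed

lemma (in additive_map) lin_ext_mult:
  "lin_ext \<chi> \<phi> (f * g) = (\<Sum>a \<in> Poly_Mapping.keys f. \<Sum>b \<in> Poly_Mapping.keys g.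
     \<chi> (Poly_Mapping.lookup f a * Poly_Mapping.lookup g b) * \<phi> (a + b))"
  by (subst mult_eq_sum_singles) (simp add: lin_ext_sum lin_ext_single)

lemma (in additive_map) lin_ext_mult_hom:
  assumes "\<And>a b. \<chi> (a * b) = \<chi> a * \<chi> b" "\<And>a b. \<phi> (a + b) = \<phi> a * \<phi> b"
  shows "lin_ext \<chi> \<phi> (f * g) = lin_ext \<chi> \<phi> f * lin_ext \<chi> \<phi> g"
  unfolding lin_ext_mult unfolding lin_ext_def sum_product
  by (intro sum.cong refl) (simp add: assms algebra_simps)

interpretation real_id: additive_map "\<lambda>c::real. c"
  by unfold_locales simp

interpretation const: additive_map Const
  by unfold_locales (simp add: Const_def single_add)

lemma Const_mult: "Const (a * b) = Const a * Const b"
  by (simp add: Const_def mult_single)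

section \<open>Evaluation\<close>

definition monom_val :: "(nat \<Rightarrow> real) \<Rightarrow> monom \<Rightarrow> real" where
  "monom_val x m = (\<Prod>i \<in> Poly_Mapping.keys m. x i ^ Poly_Mapping.lookup m i)"

lemma monom_val_superset:
  assumes "finite A" "Poly_Mapping.keys m \<subseteq> A"
  shows "monom_val x m = (\<Prod>i\<in>A. x i ^ Poly_Mapping.lookup m i)"
  unfolding monom_val_def
  by (rule prod.mono_neutral_left) (use assms in \<open>auto simp: in_keys_iff\<close>)

lemma monom_val_add: "monom_val x (a + b) = monom_val x a * monom_val x b"
proof -
  let ?A = "Poly_Mapping.keys a \<union> Poly_Mapping.keys b"
  have "Poly_Mapping.keys (a + b) \<subseteq> ?A" by (rule keys_add)
  then show ?thesis
    by (simp add: monom_val_superset[of ?A] lookup_add power_add prod.distrib)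
qed

lemma eval_poly_lin_ext: "eval_poly x = lin_ext (\<lambda>c. c) (monom_val x)"
  by (simp add: fun_eq_iff eval_poly_def lin_ext_def monom_val_def)

lemma eval_poly_add: "eval_poly x (f + g) = eval_poly x f + eval_poly x g"
  and eval_poly_diff: "eval_poly x (f - g) = eval_poly x f - eval_poly x g"
  and eval_poly_sum: "eval_poly x (sum F A) = (\<Sum>a\<in>A. eval_poly x (F a))"
  and eval_poly_mult: "eval_poly x (f * g) = eval_poly x f * eval_poly x g"
  by (simp_all add: eval_poly_lin_ext real_id.lin_ext_add real_id.lin_ext_diff
      real_id.lin_ext_sum real_id.lin_ext_mult_hom monom_val_add)

lemma eval_poly_Const: "eval_poly x (Const c) = c"
  by (simp add: eval_poly_lin_ext Const_def real_id.lin_ext_single monom_val_def)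

lemma eval_poly_power: "eval_poly x (f ^ k) = eval_poly x f ^ k"
  by (induction k)
    (use eval_poly_Const[of x 1] in \<open>auto simp: eval_poly_mult Const_def\<close>)

lemma eval_poly_Var: "eval_poly x (Var i) = x i"
  by (simp add: eval_poly_lin_ext Var_def real_id.lin_ext_single monom_val_def)

lemma eval_power_sum: "eval_poly x (power_sum n k) = (\<Sum>i=1..n. x i ^ k)"
  by (simp add: power_sum_def eval_poly_sum eval_poly_power eval_poly_Var)

section \<open>Nonnegativity\<close>

lemma the_form_eq: "the_form n = Const (1 / 18) * power_sum n 2 ^ 5
               + Const 3 * power_sum n 8 * power_sum n 2
               + Const 6 * power_sum n 6 * power_sum n 4
               - Const 3 * power_sum n 6 * power_sum n 2 ^ 2"
  by (simp add: the_form_def power_sum_part_def numeral_eq_Suc mult.assoc)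

text \<open>The Cauchy--Schwarz inequality eliminates \<open>p\<^sub>4\<close>; the discriminant of the resulting quadratic
  in \<open>p\<^sub>2\<close> is, for \<open>p\<^sub>1 = 1\<close>, a negative multiple of \<open>(p\<^sub>3 - 1/18)\<^sup>2 (p\<^sub>3 - 1/72)\<close>.\<close>

lemma power_sum_ineq:
  fixes p1 p2 p3 p4 :: real
  assumes "p1 > 0" "p2 > 0" "p3 > 0" "p4 > 0" and cs: "p3\<^sup>2 \<le> p2 * p4"
  shows "1/18 * p1^5 + 3 * p4 * p1 + 6 * p3 * p2 - 3 * p3 * p1\<^sup>2 \<ge> 0"
proof -
  define B where "B = 1/18 * p1^5 - 3 * p3 * p1\<^sup>2"
  \<comment> \<open>This is the claim multiplied by \<open>p2\<close>, with \<open>p2 * p4\<close>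
    replaced by its lower bound \<open>p3\<^sup>2\<close>.\<close>
  let ?Q = "6 * p3 * p2\<^sup>2 + B * p2 + 3 * p3\<^sup>2 * p1"
  have "?Q \<ge> 0"
  proof (cases "B \<ge> 0")
    case True
    with assms show ?thesis by simp
  next
    case False
    then have "p1\<^sup>2 * (p1^3 - 54 * p3) < 0" by (simp add: B_def algebra_simps power_add[symmetric])
    then have "p1^3 < 54 * p3" using assms(1) by (simp add: mult_less_0_iff)
    \<comment> \<open>Only \<open>p1^3 \<le> 72 * p3\<close> is needed here: a negative
      \<open>B\<close> excludes the range of small \<open>p3\<close> in which the discriminant has
      the wrong sign.\<close>
    then have "p1 * ((18 * p3 - p1^3)\<^sup>2 * (72 * p3 - p1^3)) \<ge> 0"
      using assms by (intro mult_nonneg_nonneg) auto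
    moreover have "72 * p3^3 * p1 - B\<^sup>2 = p1 * ((18 * p3 - p1^3)\<^sup>2 * (72 * p3 - p1^3)) / 324"
      unfolding B_def by (simp add: field_simps power2_eq_square power3_eq_cube numeral_eq_Suc)
    ultimately have disc: "B\<^sup>2 \<le> 72 * p3^3 * p1" by (metis diff_ge_0_iff_ge divide_nonneg_pos zero_less_numeral)
    have "24 * p3 * ?Q = (12 * p3 * p2 + B)\<^sup>2 + (72 * p3^3 * p1 - B\<^sup>2)"
      by (simp add: power2_eq_square power3_eq_cube algebra_simps)
    then have "24 * p3 * ?Q \<ge> 0" using disc by simp
    then show ?thesis using assms(3) by (simp add: zero_le_mult_iff)
  qed
  moreover have "3 * p3\<^sup>2 * p1 \<le> 3 * (p2 * p4) * p1" using cs assms(1) by simp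
  ultimately have "6 * p3 * p2\<^sup>2 + B * p2 + 3 * (p2 * p4) * p1 \<ge> 0" by linarith
  moreover have "p2 * (1/18 * p1^5 + 3 * p4 * p1 + 6 * p3 * p2 - 3 * p3 * p1\<^sup>2) =
      6 * p3 * p2\<^sup>2 + B * p2 + 3 * (p2 * p4) * p1"
    unfolding B_def by (simp add: power2_eq_square algebra_simps)
  ultimately show ?thesis using assms(2) by (metis zero_le_mult_iff not_le)
qed

lemma nonneg_the_form: "nonneg_poly (the_form n)"
  unfolding nonneg_poly_def
proof
  fix x :: "nat \<Rightarrow> real"
  define P where "P k = (\<Sum>i=1..n. x i ^ k)" for k
  have ev: "eval_poly x (the_form n) =
      1/18 * P 2^5 + 3 * P 8 * P 2 + 6 * P 6 * P 4 - 3 * P 6 * (P 2)\<^sup>2"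
    by (simp add: the_form_eq eval_poly_add eval_poly_diff eval_poly_mult eval_poly_power
        eval_poly_Const eval_power_sum P_def)
  have "(\<Sum>i=1..n. x i ^ 2 * x i ^ 4)\<^sup>2 \<le> (\<Sum>i=1..n. (x i ^ 2)\<^sup>2) * (\<Sum>i=1..n. (x i ^ 4)\<^sup>2)"
    by (rule Cauchy_Schwarz_ineq_sum)
  then have cs: "(P 6)\<^sup>2 \<le> P 4 * P 8"
    by (simp add: P_def flip: power_add power_mult)
  show "eval_poly x (the_form n) \<ge> 0"
  proof (cases "\<forall>i\<in>{1..n}. x i = 0")
    case True
    then have "P k = 0" if "k > 0" for k using that by (simp add: P_def)
    then show ?thesis by (simp add: ev)
  next
    case False
    then obtain i where i: "i \<in> {1..n}" "x i \<noteq> 0" by blast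
    have "P k > 0" if "even k" for k
      unfolding P_def by (rule sum_pos2[OF _ i(1)]) (use i that in \<open>auto simp: zero_less_power_eq\<close>)
    then show ?thesis unfolding ev by (intro power_sum_ineq cs) auto
  qed
qed

section \<open>The form is symmetric, even and homogeneous\<close>

lemma keys_Const: "Poly_Mapping.keys (Const c) \<subseteq> {0}"
  by (simp add: Const_def)

lemma keys_power_subset:
  fixes f :: rpoly
  assumes "Poly_Mapping.keys f \<subseteq> M" "0 \<in> M" "\<And>a b. a \<in> M \<Longrightarrow> b \<in> M \<Longrightarrow> a + b \<in> M"
  shows "Poly_Mapping.keys (f ^ k) \<subseteq> M"
proof (induction k)
  case (Suc k)
  then show ?case using keys_mult[of f "f ^ k"] assms by fastforce
qed (use assms in auto)

section \<open>Degrees of monomials and homogeneity\<close>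

definition mdeg :: "monom \<Rightarrow> nat" where
  "mdeg m = (\<Sum>i \<in> Poly_Mapping.keys m. Poly_Mapping.lookup m i)"

lemma mdeg_superset:
  assumes "finite A" "Poly_Mapping.keys m \<subseteq> A"
  shows "mdeg m = (\<Sum>i\<in>A. Poly_Mapping.lookup m i)"
  unfolding mdeg_def
  by (rule sum.mono_neutral_left) (use assms in \<open>auto simp: in_keys_iff\<close>)

lemma mdeg_add: "mdeg (a + b) = mdeg a + mdeg b"
proof -
  let ?A = "Poly_Mapping.keys a \<union> Poly_Mapping.keys b"
  have "Poly_Mapping.keys (a + b) \<subseteq> ?A" by (rule keys_add)
  then show ?thesis
    by (simp add: mdeg_superset[of ?A] lookup_add sum.distrib)
qed

lemma mdeg_single [simp]: "mdeg (Poly_Mapping.single i k) = k"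
  by (simp add: mdeg_def)

lemma mdeg_zero [simp]: "mdeg 0 = 0"
  by (simp add: mdeg_def)

lemma form_of_degree_iff: "form_of_degree d f \<longleftrightarrow> Poly_Mapping.keys f \<subseteq> {m. mdeg m = d}"
  by (auto simp: form_of_degree_def mdeg_def)

lemma form_of_degree_add:
  assumes "form_of_degree d f" "form_of_degree d g"
  shows "form_of_degree d (f + g)"
  using assms keys_add[of f g] by (auto simp: form_of_degree_iff)

lemma form_of_degree_diff:
  assumes "form_of_degree d f" "form_of_degree d g"
  shows "form_of_degree d (f - g)"
  using assms keys_diff[of f g] by (auto simp: form_of_degree_iff)

lemma form_of_degree_mult:
  assumes "form_of_degree d f" "form_of_degree e g"
  shows "form_of_degree (d + e) (f * g)"
  using assms keys_mult[of f g] by (fastforce simp: form_of_degree_iff mdeg_add)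

lemma form_of_degree_Const: "form_of_degree 0 (Const c)"
  using keys_Const[of c] by (auto simp: form_of_degree_iff)

lemma Var_power: "Var i ^ k = Poly_Mapping.single (Poly_Mapping.single i k) 1"
proof (induction k)
  case (Suc k)
  then show ?case by (simp add: Var_def mult_single single_add[symmetric])
qed simp

lemma power_sum_eq: "power_sum n k = (\<Sum>i=1..n. Poly_Mapping.single (Poly_Mapping.single i k) 1)"
  by (simp add: power_sum_def Var_power)

lemma keys_power_sum: "Poly_Mapping.keys (power_sum n k) \<subseteq> (\<lambda>i. Poly_Mapping.single i k) ` {1..n}"
proof
  fix m assume "m \<in> Poly_Mapping.keys (power_sum n k)"
  then have "(\<Sum>i=1..n. Poly_Mapping.lookup (Poly_Mapping.single (Poly_Mapping.single i k) (1::real)) m) \<noteq> 0"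
    by (simp add: in_keys_iff power_sum_eq lookup_sum)
  then obtain i where "i \<in> {1..n}" "Poly_Mapping.lookup (Poly_Mapping.single (Poly_Mapping.single i k) (1::real)) m \<noteq> 0"
    by (rule sum.not_neutral_contains_not_neutral)
  then show "m \<in> (\<lambda>i. Poly_Mapping.single i k) ` {1..n}"
    by (auto simp: lookup_single when_def split: if_splits)
qed

lemma form_of_degree_power_sum: "form_of_degree k (power_sum n k)"
  using keys_power_sum[of n k] by (auto simp: form_of_degree_iff)

lemma form_of_degree_power: "form_of_degree d f \<Longrightarrow> form_of_degree (k * d) (f ^ k)"
proof (induction k)
  case 0
  then show ?case by (simp add: form_of_degree_iff)
next
  case (Suc k)
  then show ?case using form_of_degree_mult[of d f "k * d" "f ^ k"] by simp
qed

lemma form_of_degree_the_form: "form_of_degree 10 (the_form n)"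
proof -
  note F = form_of_degree_mult form_of_degree_power form_of_degree_power_sum form_of_degree_Const
  have "form_of_degree (0 + 5 * 2) (Const (1 / 18) * power_sum n 2 ^ 5)"
    "form_of_degree (0 + 8 + 2) (Const 3 * power_sum n 8 * power_sum n 2)"
    "form_of_degree (0 + 6 + 4) (Const 6 * power_sum n 6 * power_sum n 4)"
    "form_of_degree (0 + 6 + 2 * 2) (Const 3 * power_sum n 6 * power_sum n 2 ^ 2)"
    by (intro F)+
  then show ?thesis unfolding the_form_eq
    by (intro form_of_degree_add form_of_degree_diff) simp_all
qed

text \<open>\<open>M\<close> is a submonoid of the exponent vectors. Taking the vectors supported in
  \<open>{1..n}\<close> and the vectors with even entries gives membership in the polynomial ring
  and evenness from one argument.\<close>

lemma keys_the_form:
  assumes "0 \<in> M" "\<And>a b. a \<in> M \<Longrightarrow> b \<in> M \<Longrightarrow> a + b \<in> M"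
    and "\<And>i k. i \<in> {1..n} \<Longrightarrow> even k \<Longrightarrow> Poly_Mapping.single i k \<in> M"
  shows "Poly_Mapping.keys (the_form n) \<subseteq> M"
proof -
  have ps: "Poly_Mapping.keys (power_sum n k) \<subseteq> M" if "even k" for k
    using keys_power_sum[of n k] assms(3) that by blast
  have mult: "Poly_Mapping.keys (f * g) \<subseteq> M"
    if "Poly_Mapping.keys f \<subseteq> M" "Poly_Mapping.keys g \<subseteq> M" for f g :: rpoly
    using keys_mult[of f g] that assms(2) by fastforce
  have add: "Poly_Mapping.keys (f + g) \<subseteq> M"
    if "Poly_Mapping.keys f \<subseteq> M" "Poly_Mapping.keys g \<subseteq> M" for f g :: rpoly
    using keys_add[of f g] that by auto
  have diff: "Poly_Mapping.keys (f - g) \<subseteq> M"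
    if "Poly_Mapping.keys f \<subseteq> M" "Poly_Mapping.keys g \<subseteq> M" for f g :: rpoly
    using keys_diff[of f g] that by auto
  have C: "Poly_Mapping.keys (Const c) \<subseteq> M" for c
    using keys_Const[of c] assms(1) by auto
  show ?thesis unfolding the_form_eq
    by (intro add diff mult C keys_power_subset ps assms) auto
qed

lemma the_form_in_poly_ring: "the_form n \<in> poly_ring n"
proof -
  have "Poly_Mapping.keys (the_form n) \<subseteq> {m. Poly_Mapping.keys m \<subseteq> {1..n}}"
  proof (rule keys_the_form)
    fix a b :: monom
    assume "a \<in> {m. Poly_Mapping.keys m \<subseteq> {1..n}}" "b \<in> {m. Poly_Mapping.keys m \<subseteq> {1..n}}"
    then show "a + b \<in> {m. Poly_Mapping.keys m \<subseteq> {1..n}}" using keys_add[of a b] by blast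
  qed auto
  then show ?thesis by (auto simp: poly_ring_def)
qed

lemma even_poly_the_form: "even_poly (the_form n)"
proof -
  have "Poly_Mapping.keys (the_form n) \<subseteq> {m. \<forall>i. even (Poly_Mapping.lookup m i)}"
    by (rule keys_the_form) (auto simp: lookup_add lookup_single when_def)
  then show ?thesis by (auto simp: even_poly_def)
qed

lemma symmetric_poly_the_form: "symmetric_poly n (the_form n)"
  unfolding symmetric_poly_def
proof (intro allI impI)
  fix \<pi> m assume \<pi>: "\<pi> permutes {1..n}"
  have inj: "inj \<pi>" by (rule permutes_inj[OF \<pi>])
  \<comment> \<open>The extension \<open>\<tau>\<close> of \<open>\<phi>\<close> is the ring
    endomorphism that permutes the variables. It fixes constants and power sums, hence the form;
    comparing coefficients then gives the symmetry.\<close>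
  define \<phi> :: "monom \<Rightarrow> rpoly" where "\<phi> m = Poly_Mapping.single (Poly_Mapping.map_key \<pi> m) 1" for m
  define \<tau> where "\<tau> = lin_ext Const \<phi>"
  have hom: "\<phi> (a + b) = \<phi> a * \<phi> b" for a b
    by (simp add: \<phi>_def map_key_plus[OF inj] mult_single)
  note lin = const.lin_ext_add const.lin_ext_diff const.lin_ext_sum const.lin_ext_single
  have mult: "\<tau> (f * g) = \<tau> f * \<tau> g" for f g
    unfolding \<tau>_def by (rule const.lin_ext_mult_hom) (simp_all add: Const_mult hom)
  have C: "\<tau> (Const c) = Const c" for c
    unfolding \<tau>_def by (simp add: Const_def lin \<phi>_def map_key_zero[OF inj] mult_single)
  \<comment> \<open>\<open>map_key\<close> precomposes exponent vectors with \<open>\<pi>\<close>,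
    so a variable is moved by the inverse permutation.\<close>
  have single: "Poly_Mapping.map_key \<pi> (Poly_Mapping.single i k) = Poly_Mapping.single (inv \<pi> i) k" for i k
    using map_key_single[OF inj, of "inv \<pi> i" k] permutes_surj[OF \<pi>] by (simp add: surj_f_inv_f)
  have ps: "\<tau> (power_sum n k) = power_sum n k" for k
  proof -
    have "\<tau> (power_sum n k) = (\<Sum>i=1..n. Poly_Mapping.single (Poly_Mapping.single (inv \<pi> i) k) (1::real))"
      unfolding \<tau>_def power_sum_eq by (simp add: lin \<phi>_def single Const_def)
    also have "\<dots> = power_sum n k"
      unfolding power_sum_eq using sum.permute[OF permutes_inv[OF \<pi>],
        of "\<lambda>i. Poly_Mapping.single (Poly_Mapping.single i k) (1::real)"] by (simp only: o_def)
    finally show ?thesis .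
  qed
  have pow: "\<tau> (f ^ k) = \<tau> f ^ k" for f k
    by (induction k) (use C[of 1] mult in \<open>auto simp: Const_def\<close>)
  have add: "\<tau> (f + g) = \<tau> f + \<tau> g" "\<tau> (f - g) = \<tau> f - \<tau> g" for f g
    by (simp_all add: \<tau>_def lin)
  have fixed: "\<tau> (the_form n) = the_form n"
    unfolding the_form_eq by (simp only: add mult pow C ps)
  have mk_inj: "Poly_Mapping.map_key \<pi> a = Poly_Mapping.map_key \<pi> b \<longleftrightarrow> a = b" for a b :: monom
  proof
    assume eq: "Poly_Mapping.map_key \<pi> a = Poly_Mapping.map_key \<pi> b"
    show "a = b"
    proof (rule poly_mapping_eqI)
      fix k
      have "Poly_Mapping.lookup a (\<pi> (inv \<pi> k)) = Poly_Mapping.lookup b (\<pi> (inv \<pi> k))"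
        using arg_cong[OF eq, of "\<lambda>p. Poly_Mapping.lookup p (inv \<pi> k)"]
        by (simp add: map_key.rep_eq[OF inj] inj)
      then show "Poly_Mapping.lookup a k = Poly_Mapping.lookup b k"
        using permutes_surj[OF \<pi>] by (simp add: surj_f_inv_f)
    qed
  qed simp
  have "Poly_Mapping.lookup (\<tau> f) (Poly_Mapping.map_key \<pi> m) = Poly_Mapping.lookup f m" for f
    unfolding \<tau>_def lin_ext_def
    by (auto simp: \<phi>_def Const_def mult_single lookup_sum lookup_single when_def mk_inj sum.delta in_keys_iff)
  from this[of "the_form n"]
  show "Poly_Mapping.lookup (the_form n) (Poly_Mapping.map_key \<pi> m) = Poly_Mapping.lookup (the_form n) m"
    unfolding fixed .
qed

section \<open>Homogeneity of the squares\<close>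

text \<open>The hypothesis behaves like being a vertex of the Newton polytope: \<open>m + m\<close>
  has no decomposition into two exponents of \<open>q\<close> other than the trivial one, so a
  single product contributes to its coefficient.\<close>

lemma lookup_square_extremal:
  fixes q :: rpoly
  assumes "\<And>a b. a \<in> Poly_Mapping.keys q \<Longrightarrow> b \<in> Poly_Mapping.keys q \<Longrightarrow> a + b = m + m \<Longrightarrow> a = m \<and> b = m"
  shows "Poly_Mapping.lookup (q ^ 2) (m + m) = (Poly_Mapping.lookup q m)\<^sup>2"
proof -
  let ?K = "Poly_Mapping.keys q" and ?c = "Poly_Mapping.lookup q"
  have "Poly_Mapping.lookup (q ^ 2) (m + m) =
      (\<Sum>a\<in>?K. \<Sum>b\<in>?K. if a + b = m + m then ?c a * ?c b else 0)"
    unfolding power2_eq_square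
    by (subst mult_eq_sum_singles) (simp add: lookup_sum lookup_single when_def)
  also have "\<dots> = (\<Sum>a\<in>?K. \<Sum>b\<in>?K. if b = m then if a = m then ?c a * ?c b else 0 else 0)"
  proof (intro sum.cong refl)
    fix a b assume "a \<in> ?K" "b \<in> ?K"
    then have "a + b = m + m \<longleftrightarrow> b = m \<and> a = m" using assms[of a b] by blast
    then show "(if a + b = m + m then ?c a * ?c b else 0) =
        (if b = m then if a = m then ?c a * ?c b else 0 else 0)" by presburger
  qed
  also have "\<dots> = (?c m)\<^sup>2"
    by (cases "?c m = 0") (simp_all add: in_keys_iff power2_eq_square)
  finally show ?thesis .
qed

text \<open>The coefficient at \<open>m + m\<close> is the sum of the squares of the real
  coefficients at \<open>m\<close>, and one of these is nonzero. Extremality is required in the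
  union \<open>K\<close> so that it applies to every summand at once.\<close>

lemma extremal_in_keys:
  fixes qs :: "rpoly list"
  defines "K \<equiv> \<Union>q\<in>set qs. Poly_Mapping.keys q"
  assumes "m \<in> K" and ext: "\<And>a b. a \<in> K \<Longrightarrow> b \<in> K \<Longrightarrow> a + b = m + m \<Longrightarrow> a = m \<and> b = m"
  shows "m + m \<in> Poly_Mapping.keys (\<Sum>q\<leftarrow>qs. q ^ 2)"
proof -
  have "Poly_Mapping.lookup (\<Sum>q\<leftarrow>ps. q ^ 2) (m + m) = (\<Sum>q\<leftarrow>ps. (Poly_Mapping.lookup q m)\<^sup>2)"
    if "set ps \<subseteq> set qs" for ps
    using that
  proof (induction ps)
    case (Cons q ps)
    then have "Poly_Mapping.lookup (q ^ 2) (m + m) = (Poly_Mapping.lookup q m)\<^sup>2"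
      by (intro lookup_square_extremal ext) (auto simp: K_def)
    with Cons show ?case by (simp add: lookup_add)
  qed simp
  moreover have "(\<Sum>q\<leftarrow>qs. (Poly_Mapping.lookup q m)\<^sup>2) \<noteq> 0"
    using assms(2) by (subst sum_list_nonneg_eq_0_iff) (auto simp: K_def in_keys_iff)
  ultimately show ?thesis by (simp add: in_keys_iff)
qed

text \<open>If the degrees do not all agree, then the least monomial of least (of greatest) degree
  survives in the sum of squares.\<close>

lemma form_of_degree_of_sum_squares:
  assumes f: "form_of_degree (2 * d) (\<Sum>q\<leftarrow>qs. q ^ 2)" and "q \<in> set qs"
  shows "form_of_degree d q"
proof -
  define K where "K = (\<Union>q\<in>set qs. Poly_Mapping.keys q)"
  have fin: "finite K" by (simp add: K_def)
  have ext: "mdeg m = d"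
    if m: "m \<in> K" "\<And>a. a \<in> K \<Longrightarrow> mdeg a = mdeg m \<Longrightarrow> m \<le> a"
      and deg: "\<And>a b. a \<in> K \<Longrightarrow> b \<in> K \<Longrightarrow> mdeg a + mdeg b = mdeg m + mdeg m \<Longrightarrow>
        mdeg a = mdeg m \<and> mdeg b = mdeg m" for m
  proof -
    have "m + m \<in> Poly_Mapping.keys (\<Sum>q\<leftarrow>qs. q ^ 2)"
    proof (rule extremal_in_keys)
      fix a b assume ab: "a \<in> (\<Union>q\<in>set qs. Poly_Mapping.keys q)"
        "b \<in> (\<Union>q\<in>set qs. Poly_Mapping.keys q)" "a + b = m + m"
      have "mdeg a + mdeg b = mdeg m + mdeg m" using ab(3) by (metis mdeg_add)
      then have "mdeg a = mdeg m \<and> mdeg b = mdeg m"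
        using deg[of a b] ab(1,2) by (simp add: K_def)
      then have "m \<le> a" "m \<le> b" using ab m(2) by (auto simp: K_def)
      \<comment> \<open>The order on exponent vectors is compatible with addition:
        \<open>m < a\<close> and \<open>m \<le> b\<close> would give
        \<open>m + m < a + b\<close>.\<close>
      with ab(3) show "a = m \<and> b = m"
        using add_less_le_mono[of m a m b] add_le_less_mono[of m a m b] by (metis order_less_le)
    qed (use m in \<open>simp add: K_def\<close>)
    then have "mdeg (m + m) = 2 * d" using f by (auto simp: form_of_degree_iff)
    then show ?thesis by (simp add: mdeg_add)
  qed
  have least: "\<exists>m\<in>K. mdeg m = e \<and> (\<forall>a\<in>K. mdeg a = e \<longrightarrow> m \<le> a)" if "e \<in> mdeg ` K" for e
  proof -
    let ?L = "{a\<in>K. mdeg a = e}"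
    have "finite ?L" "?L \<noteq> {}" using that fin by auto
    then show ?thesis using Min_in[of ?L] Min_le[of ?L] by blast
  qed
  have "mdeg a = d" if "a \<in> K" for a
  proof -
    have ne: "mdeg ` K \<noteq> {}" "finite (mdeg ` K)" using that fin by auto
    obtain m where m: "m \<in> K" "mdeg m = Min (mdeg ` K)" "\<And>a. a \<in> K \<Longrightarrow> mdeg a = mdeg m \<Longrightarrow> m \<le> a"
      using least[OF Min_in[OF ne(2,1)]] by metis
    obtain m' where m': "m' \<in> K" "mdeg m' = Max (mdeg ` K)" "\<And>a. a \<in> K \<Longrightarrow> mdeg a = mdeg m' \<Longrightarrow> m' \<le> a"
      using least[OF Max_in[OF ne(2,1)]] by metis
    have lo: "mdeg m \<le> mdeg a" and hi: "mdeg a \<le> mdeg m'" if "a \<in> K" for a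
      using that fin by (simp_all add: m(2) m'(2))
    have "mdeg m = d"
    proof (rule ext[OF m(1,3)])
      fix a b assume "a \<in> K" "b \<in> K" "mdeg a + mdeg b = mdeg m + mdeg m"
      then show "mdeg a = mdeg m \<and> mdeg b = mdeg m" using lo[of a] lo[of b] by linarith
    qed
    moreover have "mdeg m' = d"
    proof (rule ext[OF m'(1,3)])
      fix a b assume "a \<in> K" "b \<in> K" "mdeg a + mdeg b = mdeg m' + mdeg m'"
      then show "mdeg a = mdeg m' \<and> mdeg b = mdeg m'" using hi[of a] hi[of b] by linarith
    qed
    ultimately show ?thesis using lo[OF that] hi[OF that] by simp
  qed
  then show ?thesis using assms(2) by (auto simp: form_of_degree_iff K_def)
qed

section \<open>A functional separating the form from the sums of squares\<close>

text \<open>\<open>even_binom r m\<close> is the number of \<open>r\<close>-element sets of positions at which a word with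
  \<open>m i div 2\<close> letters \<open>i\<close> (for each \<open>i\<close>) is constant.\<close>

definition even_binom :: "nat \<Rightarrow> monom \<Rightarrow> real" where
  "even_binom r m = (\<Sum>i \<in> Poly_Mapping.keys m. real ((Poly_Mapping.lookup m i div 2) choose r))"

text \<open>Counts set partitions of five positions by exponents alone, since a functional must
  depend on the monomial and not on a word for it. Pairs of disjoint constant pairs: from all pairs
  of constant pairs subtract the overlapping ones, three inside each constant triple. A constant
  triple with a disjoint constant pair: from all combinations subtract three pairs inside each
  triple, and twelve per constant quadruple for those that share exactly one position.\<close>

definition weight :: "real \<Rightarrow> monom \<Rightarrow> real" where
  "weight h m = (if \<exists>i. odd (Poly_Mapping.lookup m i) then 0 else
     1243 * h^5 + 168 * h^4 * even_binom 2 m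
     + h^3 * (101 * even_binom 3 m
         + 17 * (even_binom 2 m * (even_binom 2 m - 1) / 2 - 3 * even_binom 3 m))
     + h^2 * (57 * even_binom 4 m
         + 14 * (even_binom 3 m * even_binom 2 m - 3 * even_binom 3 m - 12 * even_binom 4 m))
     + 29 * h * even_binom 5 m)"

definition \<delta> :: "'a \<Rightarrow> 'a \<Rightarrow> real" where
  "\<delta> i j = (if i = j then 1 else 0)"

text \<open>The 52 summands are the set partitions of the five positions: a partition with \<open>b\<close> blocks
  contributes \<open>h ^ b\<close> times a coefficient depending on the block sizes, whenever the indices are
  constant on the blocks. The coefficients \<open>1243, 168, 101, 17, 57, 14, 29\<close> were found by searching
  for a functional that is nonnegative on squares and whose value on the form tends to \<open>- 1/9\<close> as
  \<open>h \<rightarrow> 0\<close>.\<close>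

definition word_weight :: "real \<Rightarrow> 'a \<Rightarrow> 'a \<Rightarrow> 'a \<Rightarrow> 'a \<Rightarrow> 'a \<Rightarrow> real" where
  "word_weight h i j k l m =
     1243 * h^5 +
     168 * h^4 * (\<delta> i j + \<delta> i k + \<delta> i l + \<delta> i m + \<delta> j k + \<delta> j l +
       \<delta> j m + \<delta> k l + \<delta> k m + \<delta> l m) +
     101 * h^3 * (\<delta> i j * \<delta> j k + \<delta> i j * \<delta> j l + \<delta> i j * \<delta> j m +
       \<delta> i k * \<delta> k l + \<delta> j k * \<delta> k l + \<delta> i k * \<delta> k m +
       \<delta> j k * \<delta> k m + \<delta> i l * \<delta> l m + \<delta> j l * \<delta> l m +
       \<delta> k l * \<delta> l m) +
     17 * h^3 * (\<delta> j k * \<delta> i l + \<delta> j k * \<delta> i m + \<delta> i k * \<delta> j l +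
       \<delta> j l * \<delta> i m + \<delta> i k * \<delta> j m + \<delta> i l * \<delta> j m +
       \<delta> i j * \<delta> k l + \<delta> k l * \<delta> i m + \<delta> k l * \<delta> j m +
       \<delta> i j * \<delta> k m + \<delta> i l * \<delta> k m + \<delta> j l * \<delta> k m +
       \<delta> i j * \<delta> l m + \<delta> i k * \<delta> l m + \<delta> j k * \<delta> l m) +
     57 * h^2 * (\<delta> i j * \<delta> j k * \<delta> k l + \<delta> i j * \<delta> j k * \<delta> k m +
       \<delta> i j * \<delta> j l * \<delta> l m + \<delta> i k * \<delta> k l * \<delta> l m +
       \<delta> j k * \<delta> k l * \<delta> l m) +
     14 * h^2 * (\<delta> j k * \<delta> k l * \<delta> i m + \<delta> i k * \<delta> k l * \<delta> j m +
       \<delta> k l * \<delta> i j * \<delta> j m + \<delta> i j * \<delta> j l * \<delta> k m +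
       \<delta> j l * \<delta> i k * \<delta> k m + \<delta> i l * \<delta> j k * \<delta> k m +
       \<delta> i j * \<delta> j k * \<delta> l m + \<delta> j k * \<delta> i l * \<delta> l m +
       \<delta> i k * \<delta> j l * \<delta> l m + \<delta> i j * \<delta> k l * \<delta> l m) +
     29 * h * (\<delta> i j * \<delta> j k * \<delta> k l * \<delta> l m)"

abbreviation sq :: "nat \<Rightarrow> monom" where
  "sq i \<equiv> Poly_Mapping.single i 2"

section \<open>From exponent vectors to words of five letters\<close>

lemma even_binom_superset:
  assumes "finite A" "Poly_Mapping.keys m \<subseteq> A" "r > 0"
  shows "even_binom r m = (\<Sum>i\<in>A. real ((Poly_Mapping.lookup m i div 2) choose r))"
  unfolding even_binom_def
  by (rule sum.mono_neutral_left) (use assms in \<open>auto simp: in_keys_iff\<close>)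

text \<open>Pascal's rule at the index \<open>j\<close>: the new letter completes a constant set
  with any \<open>r - 1\<close> of the equal letters already present.\<close>

lemma even_binom_add_sq:
  assumes "r > 0"
  shows "even_binom r (m + sq j) = even_binom r m + real ((Poly_Mapping.lookup m j div 2) choose (r - 1))"
proof -
  let ?A = "insert j (Poly_Mapping.keys m)"
  have "Poly_Mapping.keys (m + sq j) \<subseteq> ?A" using keys_add[of m "sq j"] by auto
  then have "even_binom r (m + sq j) = (\<Sum>i\<in>?A. real ((Poly_Mapping.lookup (m + sq j) i div 2) choose r))"
    using assms by (intro even_binom_superset) auto
  also have "\<dots> = (\<Sum>i\<in>?A. real ((Poly_Mapping.lookup m i div 2) choose r)
      + (if i = j then real ((Poly_Mapping.lookup m j div 2) choose (r - 1)) else 0))"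
    using assms by (intro sum.cong refl) (cases r; auto simp: lookup_add lookup_single when_def)
  also have "\<dots> = (\<Sum>i\<in>?A. real ((Poly_Mapping.lookup m i div 2) choose r))
      + real ((Poly_Mapping.lookup m j div 2) choose (r - 1))"
    by (subst sum.distrib) simp
  also have "(\<Sum>i\<in>?A. real ((Poly_Mapping.lookup m i div 2) choose r)) = even_binom r m"
    using assms by (intro even_binom_superset[symmetric]) auto
  finally show ?thesis .
qed

lemma even_binom_zero: "r > 0 \<Longrightarrow> even_binom r 0 = 0"
  by (simp add: even_binom_def)

text \<open>Counts constant \<open>r\<close>-element sets by their last position: each summand
  chooses the other \<open>r - 1\<close> among the earlier equal letters. The first position is left
  out because it would contribute only for \<open>r = 1\<close>.\<close>

definition const_subwords :: "nat \<Rightarrow> 'a \<Rightarrow> 'a \<Rightarrow> 'a \<Rightarrow> 'a \<Rightarrow> 'a \<Rightarrow> real" where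
  "const_subwords r i j k l m =
    real ((if i = j then 1 else 0) choose (r - 1))
    + real (((if i = k then 1 else 0) + (if j = k then 1 else 0)) choose (r - 1))
    + real (((if i = l then 1 else 0) + (if j = l then 1 else 0) + (if k = l then 1 else 0)) choose (r - 1))
    + real (((if i = m then 1 else 0) + (if j = m then 1 else 0) + (if k = m then 1 else 0)
        + (if l = m then 1 else 0)) choose (r - 1))"

lemma even_binom_word:
  assumes "r > 1"
  shows "even_binom r (sq i + sq j + sq k + sq l + sq m) = const_subwords r i j k l m"
proof -
  have half: "Poly_Mapping.lookup (u + sq x) y div 2 = Poly_Mapping.lookup u y div 2 + (if x = y then 1 else 0)"
    "Poly_Mapping.lookup (sq x) y div 2 = (if x = y then 1 else 0)" for u x y
    by (simp_all add: lookup_add lookup_single when_def)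
  have "even_binom r (sq i) = 0"
    using even_binom_add_sq[of r 0 i] even_binom_zero[of r] assms by (simp add: binomial_eq_0)
  then show ?thesis
    using assms by (simp add: even_binom_add_sq half const_subwords_def)
qed

text \<open>The identities between sums of \<open>\<delta>\<close>s below are checked on each of the 52 patterns. They are stated
  over an arbitrary type since for naturals the premises \<open>b \<noteq> a\<close> trigger exponential case splits
  in linear arithmetic.\<close>

lemma index5_cases:
  assumes "\<And>a. P a a a a a"
    "\<And>a b. b \<noteq> a \<Longrightarrow> P a a a a b"
    "\<And>a b. b \<noteq> a \<Longrightarrow> P a a a b a"
    "\<And>a b. b \<noteq> a \<Longrightarrow> P a a a b b"
    "\<And>a b c. b \<noteq> a \<Longrightarrow> c \<noteq> a \<Longrightarrow> c \<noteq> b \<Longrightarrow> P a a a b c"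
    "\<And>a b. b \<noteq> a \<Longrightarrow> P a a b a a"
    "\<And>a b. b \<noteq> a \<Longrightarrow> P a a b a b"
    "\<And>a b c. b \<noteq> a \<Longrightarrow> c \<noteq> a \<Longrightarrow> c \<noteq> b \<Longrightarrow> P a a b a c"
    "\<And>a b. b \<noteq> a \<Longrightarrow> P a a b b a"
    "\<And>a b. b \<noteq> a \<Longrightarrow> P a a b b b"
    "\<And>a b c. b \<noteq> a \<Longrightarrow> c \<noteq> a \<Longrightarrow> c \<noteq> b \<Longrightarrow> P a a b b c"
    "\<And>a b c. b \<noteq> a \<Longrightarrow> c \<noteq> a \<Longrightarrow> c \<noteq> b \<Longrightarrow> P a a b c a"
    "\<And>a b c. b \<noteq> a \<Longrightarrow> c \<noteq> a \<Longrightarrow> c \<noteq> b \<Longrightarrow> P a a b c b"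
    "\<And>a b c. b \<noteq> a \<Longrightarrow> c \<noteq> a \<Longrightarrow> c \<noteq> b \<Longrightarrow> P a a b c c"
    "\<And>a b c d. b \<noteq> a \<Longrightarrow> c \<noteq> a \<Longrightarrow> c \<noteq> b \<Longrightarrow> d \<noteq> a \<Longrightarrow> d \<noteq> b \<Longrightarrow> d \<noteq> c \<Longrightarrow> P a a b c d"
    "\<And>a b. b \<noteq> a \<Longrightarrow> P a b a a a"
    "\<And>a b. b \<noteq> a \<Longrightarrow> P a b a a b"
    "\<And>a b c. b \<noteq> a \<Longrightarrow> c \<noteq> a \<Longrightarrow> c \<noteq> b \<Longrightarrow> P a b a a c"
    "\<And>a b. b \<noteq> a \<Longrightarrow> P a b a b a"
    "\<And>a b. b \<noteq> a \<Longrightarrow> P a b a b b"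
    "\<And>a b c. b \<noteq> a \<Longrightarrow> c \<noteq> a \<Longrightarrow> c \<noteq> b \<Longrightarrow> P a b a b c"
    "\<And>a b c. b \<noteq> a \<Longrightarrow> c \<noteq> a \<Longrightarrow> c \<noteq> b \<Longrightarrow> P a b a c a"
    "\<And>a b c. b \<noteq> a \<Longrightarrow> c \<noteq> a \<Longrightarrow> c \<noteq> b \<Longrightarrow> P a b a c b"
    "\<And>a b c. b \<noteq> a \<Longrightarrow> c \<noteq> a \<Longrightarrow> c \<noteq> b \<Longrightarrow> P a b a c c"
    "\<And>a b c d. b \<noteq> a \<Longrightarrow> c \<noteq> a \<Longrightarrow> c \<noteq> b \<Longrightarrow> d \<noteq> a \<Longrightarrow> d \<noteq> b \<Longrightarrow> d \<noteq> c \<Longrightarrow> P a b a c d"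
    "\<And>a b. b \<noteq> a \<Longrightarrow> P a b b a a"
    "\<And>a b. b \<noteq> a \<Longrightarrow> P a b b a b"
    "\<And>a b c. b \<noteq> a \<Longrightarrow> c \<noteq> a \<Longrightarrow> c \<noteq> b \<Longrightarrow> P a b b a c"
    "\<And>a b. b \<noteq> a \<Longrightarrow> P a b b b a"
    "\<And>a b. b \<noteq> a \<Longrightarrow> P a b b b b"
    "\<And>a b c. b \<noteq> a \<Longrightarrow> c \<noteq> a \<Longrightarrow> c \<noteq> b \<Longrightarrow> P a b b b c"
    "\<And>a b c. b \<noteq> a \<Longrightarrow> c \<noteq> a \<Longrightarrow> c \<noteq> b \<Longrightarrow> P a b b c a"
    "\<And>a b c. b \<noteq> a \<Longrightarrow> c \<noteq> a \<Longrightarrow> c \<noteq> b \<Longrightarrow> P a b b c b"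
    "\<And>a b c. b \<noteq> a \<Longrightarrow> c \<noteq> a \<Longrightarrow> c \<noteq> b \<Longrightarrow> P a b b c c"
    "\<And>a b c d. b \<noteq> a \<Longrightarrow> c \<noteq> a \<Longrightarrow> c \<noteq> b \<Longrightarrow> d \<noteq> a \<Longrightarrow> d \<noteq> b \<Longrightarrow> d \<noteq> c \<Longrightarrow> P a b b c d"
    "\<And>a b c. b \<noteq> a \<Longrightarrow> c \<noteq> a \<Longrightarrow> c \<noteq> b \<Longrightarrow> P a b c a a"
    "\<And>a b c. b \<noteq> a \<Longrightarrow> c \<noteq> a \<Longrightarrow> c \<noteq> b \<Longrightarrow> P a b c a b"
    "\<And>a b c. b \<noteq> a \<Longrightarrow> c \<noteq> a \<Longrightarrow> c \<noteq> b \<Longrightarrow> P a b c a c"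
    "\<And>a b c d. b \<noteq> a \<Longrightarrow> c \<noteq> a \<Longrightarrow> c \<noteq> b \<Longrightarrow> d \<noteq> a \<Longrightarrow> d \<noteq> b \<Longrightarrow> d \<noteq> c \<Longrightarrow> P a b c a d"
    "\<And>a b c. b \<noteq> a \<Longrightarrow> c \<noteq> a \<Longrightarrow> c \<noteq> b \<Longrightarrow> P a b c b a"
    "\<And>a b c. b \<noteq> a \<Longrightarrow> c \<noteq> a \<Longrightarrow> c \<noteq> b \<Longrightarrow> P a b c b b"
    "\<And>a b c. b \<noteq> a \<Longrightarrow> c \<noteq> a \<Longrightarrow> c \<noteq> b \<Longrightarrow> P a b c b c"
    "\<And>a b c d. b \<noteq> a \<Longrightarrow> c \<noteq> a \<Longrightarrow> c \<noteq> b \<Longrightarrow> d \<noteq> a \<Longrightarrow> d \<noteq> b \<Longrightarrow> d \<noteq> c \<Longrightarrow> P a b c b d"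
    "\<And>a b c. b \<noteq> a \<Longrightarrow> c \<noteq> a \<Longrightarrow> c \<noteq> b \<Longrightarrow> P a b c c a"
    "\<And>a b c. b \<noteq> a \<Longrightarrow> c \<noteq> a \<Longrightarrow> c \<noteq> b \<Longrightarrow> P a b c c b"
    "\<And>a b c. b \<noteq> a \<Longrightarrow> c \<noteq> a \<Longrightarrow> c \<noteq> b \<Longrightarrow> P a b c c c"
    "\<And>a b c d. b \<noteq> a \<Longrightarrow> c \<noteq> a \<Longrightarrow> c \<noteq> b \<Longrightarrow> d \<noteq> a \<Longrightarrow> d \<noteq> b \<Longrightarrow> d \<noteq> c \<Longrightarrow> P a b c c d"
    "\<And>a b c d. b \<noteq> a \<Longrightarrow> c \<noteq> a \<Longrightarrow> c \<noteq> b \<Longrightarrow> d \<noteq> a \<Longrightarrow> d \<noteq> b \<Longrightarrow> d \<noteq> c \<Longrightarrow> P a b c d a"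
    "\<And>a b c d. b \<noteq> a \<Longrightarrow> c \<noteq> a \<Longrightarrow> c \<noteq> b \<Longrightarrow> d \<noteq> a \<Longrightarrow> d \<noteq> b \<Longrightarrow> d \<noteq> c \<Longrightarrow> P a b c d b"
    "\<And>a b c d. b \<noteq> a \<Longrightarrow> c \<noteq> a \<Longrightarrow> c \<noteq> b \<Longrightarrow> d \<noteq> a \<Longrightarrow> d \<noteq> b \<Longrightarrow> d \<noteq> c \<Longrightarrow> P a b c d c"
    "\<And>a b c d. b \<noteq> a \<Longrightarrow> c \<noteq> a \<Longrightarrow> c \<noteq> b \<Longrightarrow> d \<noteq> a \<Longrightarrow> d \<noteq> b \<Longrightarrow> d \<noteq> c \<Longrightarrow> P a b c d d"
    "\<And>a b c d e. b \<noteq> a \<Longrightarrow> c \<noteq> a \<Longrightarrow> c \<noteq> b \<Longrightarrow> d \<noteq> a \<Longrightarrow> d \<noteq> b \<Longrightarrow> d \<noteq> c \<Longrightarrow> e \<noteq> a \<Longrightarrow> e \<noteq> b \<Longrightarrow> e \<noteq> c \<Longrightarrow> e \<noteq> d \<Longrightarrow> P a b c d e"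
  shows "P i j k l m"
  by (cases "j = i"; cases "k = i"; cases "k = j"; cases "l = i"; cases "l = j"; cases "l = k";
      cases "m = i"; cases "m = j"; cases "m = k"; cases "m = l"; simp add: assms)


text \<open>The six equations treat the block types 2+1+1+1, 3+1+1, 2+2+1, 4+1, 3+2 and 5 in this
  order. On the left stand the counts as they occur in \<open>weight\<close>, on the right the lists
  of set partitions in \<open>word_weight\<close>.\<close>

lemma const_subwords_eq:
  fixes i j k l m :: 'a
  shows "const_subwords 2 i j k l m =
      \<delta> i j + \<delta> i k + \<delta> i l + \<delta> i m + \<delta> j k + \<delta> j l +
      \<delta> j m + \<delta> k l + \<delta> k m + \<delta> l m"
    and "const_subwords 3 i j k l m =
      \<delta> i j * \<delta> j k + \<delta> i j * \<delta> j l + \<delta> i j * \<delta> j m +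
      \<delta> i k * \<delta> k l + \<delta> j k * \<delta> k l + \<delta> i k * \<delta> k m +
      \<delta> j k * \<delta> k m + \<delta> i l * \<delta> l m + \<delta> j l * \<delta> l m +
      \<delta> k l * \<delta> l m"
    and "const_subwords 2 i j k l m * (const_subwords 2 i j k l m - 1) / 2 - 3 * const_subwords 3 i j k l m =
      \<delta> j k * \<delta> i l + \<delta> j k * \<delta> i m + \<delta> i k * \<delta> j l +
      \<delta> j l * \<delta> i m + \<delta> i k * \<delta> j m + \<delta> i l * \<delta> j m +
      \<delta> i j * \<delta> k l + \<delta> k l * \<delta> i m + \<delta> k l * \<delta> j m +
      \<delta> i j * \<delta> k m + \<delta> i l * \<delta> k m + \<delta> j l * \<delta> k m +
      \<delta> i j * \<delta> l m + \<delta> i k * \<delta> l m + \<delta> j k * \<delta> l m"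
    and "const_subwords 4 i j k l m =
      \<delta> i j * \<delta> j k * \<delta> k l + \<delta> i j * \<delta> j k * \<delta> k m +
      \<delta> i j * \<delta> j l * \<delta> l m + \<delta> i k * \<delta> k l * \<delta> l m +
      \<delta> j k * \<delta> k l * \<delta> l m"
    and "const_subwords 3 i j k l m * const_subwords 2 i j k l m - 3 * const_subwords 3 i j k l m - 12 * const_subwords 4 i j k l m =
      \<delta> j k * \<delta> k l * \<delta> i m + \<delta> i k * \<delta> k l * \<delta> j m +
      \<delta> k l * \<delta> i j * \<delta> j m + \<delta> i j * \<delta> j l * \<delta> k m +
      \<delta> j l * \<delta> i k * \<delta> k m + \<delta> i l * \<delta> j k * \<delta> k m +
      \<delta> i j * \<delta> j k * \<delta> l m + \<delta> j k * \<delta> i l * \<delta> l m +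
      \<delta> i k * \<delta> j l * \<delta> l m + \<delta> i j * \<delta> k l * \<delta> l m"
    and "const_subwords 5 i j k l m =
      \<delta> i j * \<delta> j k * \<delta> k l * \<delta> l m"
proof -
  have C: "(0::nat) choose 2 = 0" "(0::nat) choose 3 = 0" "(0::nat) choose 4 = 0" "Suc 0 choose 2 = 0" "Suc 0 choose 3 = 0" "Suc 0 choose 4 = 0"
    "Suc (Suc 0) choose 2 = 1" "Suc (Suc 0) choose 3 = 0" "Suc (Suc 0) choose 4 = 0"
    "Suc (Suc (Suc 0)) choose 2 = 3" "Suc (Suc (Suc 0)) choose 3 = 1" "Suc (Suc (Suc 0)) choose 4 = 0"
    "Suc (Suc (Suc (Suc 0))) choose 2 = 6" "Suc (Suc (Suc (Suc 0))) choose 3 = 4"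
    "Suc (Suc (Suc (Suc 0))) choose 4 = 1"
    by (simp_all add: numeral_eq_Suc)
  note S = const_subwords_def \<delta>_def C
  show "const_subwords 2 i j k l m =
      \<delta> i j + \<delta> i k + \<delta> i l + \<delta> i m + \<delta> j k + \<delta> j l +
      \<delta> j m + \<delta> k l + \<delta> k m + \<delta> l m"
    by (rule index5_cases[of "\<lambda>i j k l m. const_subwords 2 i j k l m =
      \<delta> i j + \<delta> i k + \<delta> i l + \<delta> i m + \<delta> j k + \<delta> j l +
      \<delta> j m + \<delta> k l + \<delta> k m + \<delta> l m"]; simp add: S)
  show "const_subwords 3 i j k l m =
      \<delta> i j * \<delta> j k + \<delta> i j * \<delta> j l + \<delta> i j * \<delta> j m +
      \<delta> i k * \<delta> k l + \<delta> j k * \<delta> k l + \<delta> i k * \<delta> k m +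
      \<delta> j k * \<delta> k m + \<delta> i l * \<delta> l m + \<delta> j l * \<delta> l m +
      \<delta> k l * \<delta> l m"
    by (rule index5_cases[of "\<lambda>i j k l m. const_subwords 3 i j k l m =
      \<delta> i j * \<delta> j k + \<delta> i j * \<delta> j l + \<delta> i j * \<delta> j m +
      \<delta> i k * \<delta> k l + \<delta> j k * \<delta> k l + \<delta> i k * \<delta> k m +
      \<delta> j k * \<delta> k m + \<delta> i l * \<delta> l m + \<delta> j l * \<delta> l m +
      \<delta> k l * \<delta> l m"]; simp add: S)
  show "const_subwords 2 i j k l m * (const_subwords 2 i j k l m - 1) / 2 - 3 * const_subwords 3 i j k l m =
      \<delta> j k * \<delta> i l + \<delta> j k * \<delta> i m + \<delta> i k * \<delta> j l +
      \<delta> j l * \<delta> i m + \<delta> i k * \<delta> j m + \<delta> i l * \<delta> j m +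
      \<delta> i j * \<delta> k l + \<delta> k l * \<delta> i m + \<delta> k l * \<delta> j m +
      \<delta> i j * \<delta> k m + \<delta> i l * \<delta> k m + \<delta> j l * \<delta> k m +
      \<delta> i j * \<delta> l m + \<delta> i k * \<delta> l m + \<delta> j k * \<delta> l m"
    by (rule index5_cases[of "\<lambda>i j k l m. const_subwords 2 i j k l m * (const_subwords 2 i j k l m - 1) / 2 - 3 * const_subwords 3 i j k l m =
      \<delta> j k * \<delta> i l + \<delta> j k * \<delta> i m + \<delta> i k * \<delta> j l +
      \<delta> j l * \<delta> i m + \<delta> i k * \<delta> j m + \<delta> i l * \<delta> j m +
      \<delta> i j * \<delta> k l + \<delta> k l * \<delta> i m + \<delta> k l * \<delta> j m +
      \<delta> i j * \<delta> k m + \<delta> i l * \<delta> k m + \<delta> j l * \<delta> k m +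
      \<delta> i j * \<delta> l m + \<delta> i k * \<delta> l m + \<delta> j k * \<delta> l m"]; simp add: S)
  show "const_subwords 4 i j k l m =
      \<delta> i j * \<delta> j k * \<delta> k l + \<delta> i j * \<delta> j k * \<delta> k m +
      \<delta> i j * \<delta> j l * \<delta> l m + \<delta> i k * \<delta> k l * \<delta> l m +
      \<delta> j k * \<delta> k l * \<delta> l m"
    by (rule index5_cases[of "\<lambda>i j k l m. const_subwords 4 i j k l m =
      \<delta> i j * \<delta> j k * \<delta> k l + \<delta> i j * \<delta> j k * \<delta> k m +
      \<delta> i j * \<delta> j l * \<delta> l m + \<delta> i k * \<delta> k l * \<delta> l m +
      \<delta> j k * \<delta> k l * \<delta> l m"]; simp add: S)
  show "const_subwords 3 i j k l m * const_subwords 2 i j k l m - 3 * const_subwords 3 i j k l m - 12 * const_subwords 4 i j k l m =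
      \<delta> j k * \<delta> k l * \<delta> i m + \<delta> i k * \<delta> k l * \<delta> j m +
      \<delta> k l * \<delta> i j * \<delta> j m + \<delta> i j * \<delta> j l * \<delta> k m +
      \<delta> j l * \<delta> i k * \<delta> k m + \<delta> i l * \<delta> j k * \<delta> k m +
      \<delta> i j * \<delta> j k * \<delta> l m + \<delta> j k * \<delta> i l * \<delta> l m +
      \<delta> i k * \<delta> j l * \<delta> l m + \<delta> i j * \<delta> k l * \<delta> l m"
    by (rule index5_cases[of "\<lambda>i j k l m. const_subwords 3 i j k l m * const_subwords 2 i j k l m - 3 * const_subwords 3 i j k l m - 12 * const_subwords 4 i j k l m =
      \<delta> j k * \<delta> k l * \<delta> i m + \<delta> i k * \<delta> k l * \<delta> j m +
      \<delta> k l * \<delta> i j * \<delta> j m + \<delta> i j * \<delta> j l * \<delta> k m +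
      \<delta> j l * \<delta> i k * \<delta> k m + \<delta> i l * \<delta> j k * \<delta> k m +
      \<delta> i j * \<delta> j k * \<delta> l m + \<delta> j k * \<delta> i l * \<delta> l m +
      \<delta> i k * \<delta> j l * \<delta> l m + \<delta> i j * \<delta> k l * \<delta> l m"]; simp add: S)
  show "const_subwords 5 i j k l m =
      \<delta> i j * \<delta> j k * \<delta> k l * \<delta> l m"
    by (rule index5_cases[of "\<lambda>i j k l m. const_subwords 5 i j k l m =
      \<delta> i j * \<delta> j k * \<delta> k l * \<delta> l m"]; simp add: S)
qed

lemma weight_word: "weight h (sq i + sq j + sq k + sq l + sq m) = word_weight h i j k l m"
proof -
  have "even (Poly_Mapping.lookup (sq i + sq j + sq k + sq l + sq m) x)" for x
    by (simp add: lookup_add lookup_single when_def)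
  then show ?thesis
    unfolding word_weight_def const_subwords_eq[symmetric]
    by (simp add: weight_def even_binom_word) (simp add: algebra_simps)
qed

section \<open>Positive semidefiniteness\<close>

text \<open>The squares in the next two proofs are read off the \<open>LDL\<^sup>T\<close> decompositions of the matrices.\<close>

lemma ternary_form_nonneg:
  fixes u v w :: real
  shows "57 * (u * u) + 202 * (u * v) + 28 * (u * w) + 185 * (v * v) + 34 * (v * w) + 14 * (w * w) \<ge> 0"
proof -
  have "57 * (u * u) + 202 * (u * v) + 28 * (u * w) + 185 * (v * v) + 34 * (v * w) + 14 * (w * w) =
    57 * (u + 101/57 * v + 14/57 * w)\<^sup>2 + 344/57 * (v - 445/344 * w)\<^sup>2 + 159/344 * w\<^sup>2"
    by (simp add: power2_eq_square field_simps)
  then show ?thesis by simp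
qed

lemma quaternary_form_nonneg:
  fixes a s d r :: real
  shows "29 * (a * a) + 228 * (a * s) + 28 * (a * d) + 202 * (a * r) + 460 * (s * s) + 124 * (s * d)
    + 808 * (s * r) + 74 * (d * d) + 740 * (d * r) + 1949 * (r * r) \<ge> 0"
proof -
  have "29 * (a * a) + 228 * (a * s) + 28 * (a * d) + 202 * (a * r) + 460 * (s * s) + 124 * (s * d)
    + 808 * (s * r) + 74 * (d * d) + 740 * (d * r) + 1949 * (r * r) =
    29 * (a + 114/29 * s + 14/29 * d + 101/29 * r)\<^sup>2 + 344/29 * (s + 101/172 * d + 101/172 * r)\<^sup>2
    + 5431/86 * (d + 27275/5431 * r)\<^sup>2 + 2106/5431 * r\<^sup>2"
    by (simp add: power2_eq_square field_simps)
  then show ?thesis by simp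
qed

text \<open>The covariance identity, with means \<open>h * sum u I\<close> and
  \<open>h * sum v I\<close>. For \<open>u = v\<close> it gives Cauchy-Schwarz against the constant
  vector.\<close>

lemma sum_centered:
  fixes u v :: "'i \<Rightarrow> real"
  assumes "h * real (card I) = 1"
  shows "(\<Sum>x\<in>I. (u x - h * sum u I) * (v x - h * sum v I)) = (\<Sum>x\<in>I. u x * v x) - h * (sum u I * sum v I)"
proof -
  have "(\<Sum>x\<in>I. (u x - h * sum u I) * (v x - h * sum v I)) =
     (\<Sum>x\<in>I. u x * v x) - h * sum v I * sum u I - h * sum u I * sum v I
       + real (card I) * (h * sum u I * (h * sum v I))"
    by (simp add: algebra_simps sum.distrib sum_subtractf sum_distrib_left[symmetric] sum_distrib_right[symmetric])
  also have "real (card I) * (h * sum u I * (h * sum v I)) = h * (sum u I * sum v I) * (h * real (card I))"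
    by simp
  finally show ?thesis using assms by simp
qed

text \<open>Here \<open>a\<close>, \<open>s\<close>, \<open>D\<close>, \<open>R\<close>, \<open>r\<close>, \<open>d\<close>, \<open>b\<close> are, for a symmetric matrix \<open>c\<close> and a fixed index \<open>i\<close>:
  the entry \<open>c i i\<close>, the \<open>i\<close>-th row sum, the trace, the total sum, the row sums, the diagonal and
  the \<open>i\<close>-th row.\<close>

lemma centered_form_nonneg:
  fixes a h :: real and r d b :: "'i \<Rightarrow> real" and c :: "'i \<Rightarrow> 'i \<Rightarrow> real"
  assumes I: "finite I" "h * real (card I) = 1" and h: "h > 0"
    and R: "sum r I = R" and D: "sum d I = D" and s: "sum b I = s"
    and row: "\<And>x. x \<in> I \<Longrightarrow> (\<Sum>y\<in>I. c x y) = r x" and col: "\<And>y. y \<in> I \<Longrightarrow> (\<Sum>x\<in>I. c x y) = r y"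
  shows "1243 * h^5 * (R * R)
     + 168 * h^4 * (4 * (s * R) + 2 * (D * R) + 4 * (\<Sum>x\<in>I. r x * r x))
     + 101 * h^3 * (2 * (a * R) + 4 * (s * s) + 4 * (\<Sum>x\<in>I. d x * r x))
     + 17 * h^3 * (D * D + 2 * (\<Sum>x\<in>I. \<Sum>y\<in>I. c x y * c x y) + 4 * (s * D) + 8 * (\<Sum>x\<in>I. r x * b x))
     + 57 * h^2 * ((\<Sum>x\<in>I. d x * d x) + 4 * (a * s))
     + 14 * h^2 * (2 * (a * D) + 4 * (\<Sum>x\<in>I. b x * b x) + 4 * (\<Sum>x\<in>I. d x * b x))
     + 29 * h * (a * a) \<ge> 0"
proof -
  let ?rr = "\<Sum>x\<in>I. r x * r x" and ?cc = "\<Sum>x\<in>I. \<Sum>y\<in>I. c x y * c x y"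
  let ?dr = "\<Sum>x\<in>I. d x * r x" and ?rb = "\<Sum>x\<in>I. r x * b x" and ?dd = "\<Sum>x\<in>I. d x * d x"
  let ?bb = "\<Sum>x\<in>I. b x * b x" and ?db = "\<Sum>x\<in>I. d x * b x"
  have bessel: "h * (sum u I * sum u I) \<le> (\<Sum>x\<in>I. u x * u x)" for u
  proof -
    have "0 \<le> (\<Sum>x\<in>I. (u x - h * sum u I) * (u x - h * sum u I))" by (intro sum_nonneg) simp
    then show ?thesis unfolding sum_centered[OF I(2)] by simp
  qed
  \<comment> \<open>The matrix is centered along its rows, then \<open>bessel\<close> is applied to
    the columns of the result. This amounts to nonnegativity of the squared norm of the doubly
    centered matrix and bounds \<open>?cc\<close> below by
    \<open>2 * h * ?rr - h^2 * (R * R)\<close>, so that only vectors remain.\<close>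
  have "(\<Sum>x\<in>I. \<Sum>y\<in>I. (c x y - h * r x) * (c x y - h * r x)) = ?cc - h * ?rr"
  proof -
    have "(\<Sum>y\<in>I. (c x y - h * r x) * (c x y - h * r x)) = (\<Sum>y\<in>I. c x y * c x y) - h * (r x * r x)"
      if "x \<in> I" for x
      using sum_centered[OF I(2), of "c x" "c x"] by (simp only: row[OF that])
    then show ?thesis by (simp add: sum_subtractf sum_distrib_left)
  qed
  moreover have "(\<Sum>x\<in>I. \<Sum>y\<in>I. (c x y - h * r x) * (c x y - h * r x)) \<ge>
      (\<Sum>y\<in>I. h * ((r y - h * R) * (r y - h * R)))"
  proof (subst sum.swap, intro sum_mono)
    fix y assume "y \<in> I"
    then have "(\<Sum>x\<in>I. c x y - h * r x) = r y - h * R"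
      by (simp add: sum_subtractf col sum_distrib_left[symmetric] R)
    then show "h * ((r y - h * R) * (r y - h * R)) \<le> (\<Sum>x\<in>I. (c x y - h * r x) * (c x y - h * r x))"
      using bessel[of "\<lambda>x. c x y - h * r x"] by simp
  qed
  moreover have "(\<Sum>y\<in>I. h * ((r y - h * R) * (r y - h * R))) = h * (?rr - h * (R * R))"
    using sum_centered[OF I(2), of r r] by (simp add: R sum_distrib_left[symmetric])
  ultimately have "2 * h * ?rr - h^2 * (R * R) \<le> ?cc"
    by (simp add: algebra_simps power2_eq_square)
  then have cc: "34 * h^3 * (2 * h * ?rr - h^2 * (R * R)) \<le> 34 * h^3 * ?cc"
    using h by (intro mult_left_mono) simp_all
  \<comment> \<open>The factors \<open>2 * h\<close> and \<open>2\<close> clear powers of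
    \<open>h\<close> from the coefficients. For instance
    \<open>4 * 185 = 740 = 4 * 168 + 2 * 34\<close>, where the part with 34 comes from the bound on
    \<open>?cc\<close>.\<close>
  let ?u = "\<lambda>x. d x - h * D" and ?v = "\<lambda>x. 2 * h * (r x - h * R)" and ?w = "\<lambda>x. 2 * (b x - h * s)"
  have "0 \<le> (\<Sum>x\<in>I. 57 * (?u x * ?u x) + 202 * (?u x * ?v x) + 28 * (?u x * ?w x)
      + 185 * (?v x * ?v x) + 34 * (?v x * ?w x) + 14 * (?w x * ?w x))"
    by (intro sum_nonneg ternary_form_nonneg)
  also have "\<dots> = (\<Sum>x\<in>I. 57 * ((d x - h * D) * (d x - h * D)) + 404 * h * ((d x - h * D) * (r x - h * R))
      + 56 * ((d x - h * D) * (b x - h * s)) + 740 * h^2 * ((r x - h * R) * (r x - h * R))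
      + 136 * h * ((r x - h * R) * (b x - h * s)) + 56 * ((b x - h * s) * (b x - h * s)))"
    by (intro sum.cong refl) (simp add: power2_eq_square algebra_simps)
  also have "\<dots> = 57 * (?dd - h * (D * D)) + 404 * h * (?dr - h * (D * R)) + 56 * (?db - h * (D * s))
      + 740 * h^2 * (?rr - h * (R * R)) + 136 * h * (?rb - h * (R * s)) + 56 * (?bb - h * (s * s))"
    unfolding sum.distrib sum_distrib_left[symmetric] R[symmetric] D[symmetric] s[symmetric]
      sum_centered[OF I(2)] by (rule refl)
  finally have F2: "0 \<le> h^2 * \<dots>" using h by simp
  \<comment> \<open>The contribution of the means: every sum of products is replaced by
    \<open>h\<close> times the product of the sums. For instance
    \<open>460 = 4 * 101 + 4 * 14\<close> and \<open>1949 = 1243 + 4 * 168 + 34\<close>, the last 34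
    again from the bound on \<open>?cc\<close>.\<close>
  have "29 * (a * a) + 228 * (a * (h * s)) + 28 * (a * (h * D)) + 202 * (a * (h^2 * R)) + 460 * ((h * s) * (h * s))
      + 124 * ((h * s) * (h * D)) + 808 * ((h * s) * (h^2 * R)) + 74 * ((h * D) * (h * D)) + 740 * ((h * D) * (h^2 * R))
      + 1949 * ((h^2 * R) * (h^2 * R)) \<ge> 0"
    by (rule quaternary_form_nonneg)
  then have F1: "0 \<le> h * (29 * (a * a) + 228 * (a * (h * s)) + 28 * (a * (h * D)) + 202 * (a * (h^2 * R)) + 460 * ((h * s) * (h * s))
      + 124 * ((h * s) * (h * D)) + 808 * ((h * s) * (h^2 * R)) + 74 * ((h * D) * (h * D)) + 740 * ((h * D) * (h^2 * R))
      + 1949 * ((h^2 * R) * (h^2 * R)))" using h by simp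
  show ?thesis using add_mono[OF cc add_nonneg_nonneg[OF F1 F2]]
    by (simp add: algebra_simps eval_nat_numeral)
qed

text \<open>The set partitions of each block type are grouped so that every bracket on the right is
  one product of the matrix quantities of \<open>centered_form_nonneg\<close>, polarized and
  evaluated at the symmetrized matrix units of \<open>(j, k)\<close> and
  \<open>(l, m)\<close>.\<close>

lemma symmetrized_sums:
  fixes i j k l m :: 'a
  shows "\<delta> i j + \<delta> i k + \<delta> i l + \<delta> i m + \<delta> j k + \<delta> j l +
    \<delta> j m + \<delta> k l + \<delta> k m + \<delta> l m
    = 4 * ((((\<delta> i j + \<delta> i k) / 2) + ((\<delta> i l + \<delta> i m) / 2)) / 2) +
    2 * ((\<delta> j k + \<delta> l m) / 2) + 4 * ((\<delta> j l + \<delta> j m +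
    \<delta> k l + \<delta> k m) / 4)"
    and "\<delta> i j * \<delta> j k + \<delta> i j * \<delta> j l + \<delta> i j * \<delta> j m +
    \<delta> i k * \<delta> k l + \<delta> j k * \<delta> k l + \<delta> i k * \<delta> k m +
    \<delta> j k * \<delta> k m + \<delta> i l * \<delta> l m + \<delta> j l * \<delta> l m +
    \<delta> k l * \<delta> l m
    = 2 * (((\<delta> i j * \<delta> j k) + (\<delta> i l * \<delta> l m)) / 2) +
    4 * ((\<delta> i j + \<delta> i k) / 2) * ((\<delta> i l + \<delta> i m) / 2) +
    4 * (((\<delta> j k * (\<delta> j l + \<delta> j m) / 2) + (\<delta> l m * (\<delta> j l +
    \<delta> k l) / 2)) / 2)"
    and "\<delta> j k * \<delta> i l + \<delta> j k * \<delta> i m + \<delta> i k * \<delta> j l +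
    \<delta> j l * \<delta> i m + \<delta> i k * \<delta> j m + \<delta> i l * \<delta> j m +
    \<delta> i j * \<delta> k l + \<delta> k l * \<delta> i m + \<delta> k l * \<delta> j m +
    \<delta> i j * \<delta> k m + \<delta> i l * \<delta> k m + \<delta> j l * \<delta> k m +
    \<delta> i j * \<delta> l m + \<delta> i k * \<delta> l m + \<delta> j k * \<delta> l m
    = \<delta> j k * \<delta> l m + 2 * ((\<delta> j l * \<delta> k m +
    \<delta> j m * \<delta> k l) / 2) + 4 * ((((\<delta> i j +
    \<delta> i k) / 2) * \<delta> l m + \<delta> j k * ((\<delta> i l +
    \<delta> i m) / 2)) / 2) + 8 * ((((\<delta> i l * (\<delta> j m + \<delta> k m) +
    \<delta> i m * (\<delta> j l + \<delta> k l)) / 4) + ((\<delta> i j * (\<delta> k l +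
    \<delta> k m) + \<delta> i k * (\<delta> j l + \<delta> j m)) / 4)) / 2)"
    and "\<delta> i j * \<delta> j k * \<delta> k l + \<delta> i j * \<delta> j k * \<delta> k m +
    \<delta> i j * \<delta> j l * \<delta> l m + \<delta> i k * \<delta> k l * \<delta> l m +
    \<delta> j k * \<delta> k l * \<delta> l m
    = \<delta> j k * \<delta> j l * \<delta> l m +
    4 * (((\<delta> i j * \<delta> j k) * ((\<delta> i l + \<delta> i m) / 2) +
    ((\<delta> i j + \<delta> i k) / 2) * (\<delta> i l * \<delta> l m)) / 2)"
    and "\<delta> j k * \<delta> k l * \<delta> i m + \<delta> i k * \<delta> k l * \<delta> j m +
    \<delta> k l * \<delta> i j * \<delta> j m + \<delta> i j * \<delta> j l * \<delta> k m +
    \<delta> j l * \<delta> i k * \<delta> k m + \<delta> i l * \<delta> j k * \<delta> k m +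
    \<delta> i j * \<delta> j k * \<delta> l m + \<delta> j k * \<delta> i l * \<delta> l m +
    \<delta> i k * \<delta> j l * \<delta> l m + \<delta> i j * \<delta> k l * \<delta> l m
    = 2 * (((\<delta> i j * \<delta> j k) * \<delta> l m +
    \<delta> j k * (\<delta> i l * \<delta> l m)) / 2) +
    4 * ((\<delta> i j * \<delta> i l * \<delta> k m +
    \<delta> i j * \<delta> i m * \<delta> k l + \<delta> i k * \<delta> i l * \<delta> j m +
    \<delta> i k * \<delta> i m * \<delta> j l) / 4) +
    4 * (((\<delta> j k * (\<delta> i l * \<delta> j m + \<delta> i m * \<delta> j l) / 2) +
    (\<delta> l m * (\<delta> i j * \<delta> k l + \<delta> i k * \<delta> j l) / 2)) / 2)"
proof -
  show "\<delta> i j + \<delta> i k + \<delta> i l + \<delta> i m + \<delta> j k + \<delta> j l +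
    \<delta> j m + \<delta> k l + \<delta> k m + \<delta> l m
    = 4 * ((((\<delta> i j + \<delta> i k) / 2) + ((\<delta> i l + \<delta> i m) / 2)) / 2) +
    2 * ((\<delta> j k + \<delta> l m) / 2) + 4 * ((\<delta> j l + \<delta> j m +
    \<delta> k l + \<delta> k m) / 4)"
    by (rule index5_cases[of "\<lambda>i j k l m. \<delta> i j + \<delta> i k + \<delta> i l + \<delta> i m + \<delta> j k + \<delta> j l +
    \<delta> j m + \<delta> k l + \<delta> k m + \<delta> l m
    = 4 * ((((\<delta> i j + \<delta> i k) / 2) + ((\<delta> i l + \<delta> i m) / 2)) / 2) +
    2 * ((\<delta> j k + \<delta> l m) / 2) + 4 * ((\<delta> j l + \<delta> j m +
    \<delta> k l + \<delta> k m) / 4)"]; simp add: \<delta>_def)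
  show "\<delta> i j * \<delta> j k + \<delta> i j * \<delta> j l + \<delta> i j * \<delta> j m +
    \<delta> i k * \<delta> k l + \<delta> j k * \<delta> k l + \<delta> i k * \<delta> k m +
    \<delta> j k * \<delta> k m + \<delta> i l * \<delta> l m + \<delta> j l * \<delta> l m +
    \<delta> k l * \<delta> l m
    = 2 * (((\<delta> i j * \<delta> j k) + (\<delta> i l * \<delta> l m)) / 2) +
    4 * ((\<delta> i j + \<delta> i k) / 2) * ((\<delta> i l + \<delta> i m) / 2) +
    4 * (((\<delta> j k * (\<delta> j l + \<delta> j m) / 2) + (\<delta> l m * (\<delta> j l +
    \<delta> k l) / 2)) / 2)"
    by (rule index5_cases[of "\<lambda>i j k l m. \<delta> i j * \<delta> j k + \<delta> i j * \<delta> j l + \<delta> i j * \<delta> j m +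
    \<delta> i k * \<delta> k l + \<delta> j k * \<delta> k l + \<delta> i k * \<delta> k m +
    \<delta> j k * \<delta> k m + \<delta> i l * \<delta> l m + \<delta> j l * \<delta> l m +
    \<delta> k l * \<delta> l m
    = 2 * (((\<delta> i j * \<delta> j k) + (\<delta> i l * \<delta> l m)) / 2) +
    4 * ((\<delta> i j + \<delta> i k) / 2) * ((\<delta> i l + \<delta> i m) / 2) +
    4 * (((\<delta> j k * (\<delta> j l + \<delta> j m) / 2) + (\<delta> l m * (\<delta> j l +
    \<delta> k l) / 2)) / 2)"]; simp add: \<delta>_def)
  show "\<delta> j k * \<delta> i l + \<delta> j k * \<delta> i m + \<delta> i k * \<delta> j l +
    \<delta> j l * \<delta> i m + \<delta> i k * \<delta> j m + \<delta> i l * \<delta> j m +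
    \<delta> i j * \<delta> k l + \<delta> k l * \<delta> i m + \<delta> k l * \<delta> j m +
    \<delta> i j * \<delta> k m + \<delta> i l * \<delta> k m + \<delta> j l * \<delta> k m +
    \<delta> i j * \<delta> l m + \<delta> i k * \<delta> l m + \<delta> j k * \<delta> l m
    = \<delta> j k * \<delta> l m + 2 * ((\<delta> j l * \<delta> k m +
    \<delta> j m * \<delta> k l) / 2) + 4 * ((((\<delta> i j +
    \<delta> i k) / 2) * \<delta> l m + \<delta> j k * ((\<delta> i l +
    \<delta> i m) / 2)) / 2) + 8 * ((((\<delta> i l * (\<delta> j m + \<delta> k m) +
    \<delta> i m * (\<delta> j l + \<delta> k l)) / 4) + ((\<delta> i j * (\<delta> k l +
    \<delta> k m) + \<delta> i k * (\<delta> j l + \<delta> j m)) / 4)) / 2)"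
    by (rule index5_cases[of "\<lambda>i j k l m. \<delta> j k * \<delta> i l + \<delta> j k * \<delta> i m + \<delta> i k * \<delta> j l +
    \<delta> j l * \<delta> i m + \<delta> i k * \<delta> j m + \<delta> i l * \<delta> j m +
    \<delta> i j * \<delta> k l + \<delta> k l * \<delta> i m + \<delta> k l * \<delta> j m +
    \<delta> i j * \<delta> k m + \<delta> i l * \<delta> k m + \<delta> j l * \<delta> k m +
    \<delta> i j * \<delta> l m + \<delta> i k * \<delta> l m + \<delta> j k * \<delta> l m
    = \<delta> j k * \<delta> l m + 2 * ((\<delta> j l * \<delta> k m +
    \<delta> j m * \<delta> k l) / 2) + 4 * ((((\<delta> i j +
    \<delta> i k) / 2) * \<delta> l m + \<delta> j k * ((\<delta> i l +
    \<delta> i m) / 2)) / 2) + 8 * ((((\<delta> i l * (\<delta> j m + \<delta> k m) +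
    \<delta> i m * (\<delta> j l + \<delta> k l)) / 4) + ((\<delta> i j * (\<delta> k l +
    \<delta> k m) + \<delta> i k * (\<delta> j l + \<delta> j m)) / 4)) / 2)"]; simp add: \<delta>_def)
  show "\<delta> i j * \<delta> j k * \<delta> k l + \<delta> i j * \<delta> j k * \<delta> k m +
    \<delta> i j * \<delta> j l * \<delta> l m + \<delta> i k * \<delta> k l * \<delta> l m +
    \<delta> j k * \<delta> k l * \<delta> l m
    = \<delta> j k * \<delta> j l * \<delta> l m +
    4 * (((\<delta> i j * \<delta> j k) * ((\<delta> i l + \<delta> i m) / 2) +
    ((\<delta> i j + \<delta> i k) / 2) * (\<delta> i l * \<delta> l m)) / 2)"
    by (rule index5_cases[of "\<lambda>i j k l m. \<delta> i j * \<delta> j k * \<delta> k l + \<delta> i j * \<delta> j k * \<delta> k m +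
    \<delta> i j * \<delta> j l * \<delta> l m + \<delta> i k * \<delta> k l * \<delta> l m +
    \<delta> j k * \<delta> k l * \<delta> l m
    = \<delta> j k * \<delta> j l * \<delta> l m +
    4 * (((\<delta> i j * \<delta> j k) * ((\<delta> i l + \<delta> i m) / 2) +
    ((\<delta> i j + \<delta> i k) / 2) * (\<delta> i l * \<delta> l m)) / 2)"]; simp add: \<delta>_def)
  show "\<delta> j k * \<delta> k l * \<delta> i m + \<delta> i k * \<delta> k l * \<delta> j m +
    \<delta> k l * \<delta> i j * \<delta> j m + \<delta> i j * \<delta> j l * \<delta> k m +
    \<delta> j l * \<delta> i k * \<delta> k m + \<delta> i l * \<delta> j k * \<delta> k m +
    \<delta> i j * \<delta> j k * \<delta> l m + \<delta> j k * \<delta> i l * \<delta> l m +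
    \<delta> i k * \<delta> j l * \<delta> l m + \<delta> i j * \<delta> k l * \<delta> l m
    = 2 * (((\<delta> i j * \<delta> j k) * \<delta> l m +
    \<delta> j k * (\<delta> i l * \<delta> l m)) / 2) +
    4 * ((\<delta> i j * \<delta> i l * \<delta> k m +
    \<delta> i j * \<delta> i m * \<delta> k l + \<delta> i k * \<delta> i l * \<delta> j m +
    \<delta> i k * \<delta> i m * \<delta> j l) / 4) +
    4 * (((\<delta> j k * (\<delta> i l * \<delta> j m + \<delta> i m * \<delta> j l) / 2) +
    (\<delta> l m * (\<delta> i j * \<delta> k l + \<delta> i k * \<delta> j l) / 2)) / 2)"
    by (rule index5_cases[of "\<lambda>i j k l m. \<delta> j k * \<delta> k l * \<delta> i m + \<delta> i k * \<delta> k l * \<delta> j m +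
    \<delta> k l * \<delta> i j * \<delta> j m + \<delta> i j * \<delta> j l * \<delta> k m +
    \<delta> j l * \<delta> i k * \<delta> k m + \<delta> i l * \<delta> j k * \<delta> k m +
    \<delta> i j * \<delta> j k * \<delta> l m + \<delta> j k * \<delta> i l * \<delta> l m +
    \<delta> i k * \<delta> j l * \<delta> l m + \<delta> i j * \<delta> k l * \<delta> l m
    = 2 * (((\<delta> i j * \<delta> j k) * \<delta> l m +
    \<delta> j k * (\<delta> i l * \<delta> l m)) / 2) +
    4 * ((\<delta> i j * \<delta> i l * \<delta> k m +
    \<delta> i j * \<delta> i m * \<delta> k l + \<delta> i k * \<delta> i l * \<delta> j m +
    \<delta> i k * \<delta> i m * \<delta> j l) / 4) +
    4 * (((\<delta> j k * (\<delta> i l * \<delta> j m + \<delta> i m * \<delta> j l) / 2) +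
    (\<delta> l m * (\<delta> i j * \<delta> k l + \<delta> i k * \<delta> j l) / 2)) / 2)"]; simp add: \<delta>_def)
qed

section \<open>Kernels on words as quadratic forms\<close>

lemma sum_\<delta>_mult:
  assumes "finite I" "y \<in> I"
  shows "(\<Sum>x\<in>I. \<delta> x y * g x) = g y"
  using assms by (simp add: \<delta>_def if_distrib[of "\<lambda>t. t * _"] cong: if_cong)

lemma sum_\<delta>_mult':
  assumes "finite I" "y \<in> I"
  shows "(\<Sum>x\<in>I. g x * \<delta> x y) = g y"
  using sum_\<delta>_mult[OF assms, of g] by (simp add: mult.commute)

lemma sum_\<delta>:
  assumes "finite I" "y \<in> I"
  shows "(\<Sum>x\<in>I. \<delta> x y) = 1"
  using sum_\<delta>_mult[OF assms, of "\<lambda>_. 1"] by simp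

lemma \<delta>_commute: "\<delta> x y = \<delta> y x"
  by (simp add: \<delta>_def)

text \<open>The weights \<open>w\<close> on the index pairs \<open>(J \<alpha>, K \<alpha>)\<close> amount to the symmetric matrix \<open>\<Sum>\<alpha>. w \<alpha> * c x y (J \<alpha>) (K \<alpha>)\<close>,
  with \<open>c\<close> as defined in the proof, to which \<open>centered_form_nonneg\<close> applies.\<close>

lemma word_weight_kernel_one:
  fixes w :: "'b \<Rightarrow> real" and J K :: "'b \<Rightarrow> 'a" and I :: "'a set"
  assumes I: "finite I" "h * real (card I) = 1" "h > 0" and i: "i \<in> I"
    and JK: "\<And>\<alpha>. \<alpha> \<in> A \<Longrightarrow> J \<alpha> \<in> I" "\<And>\<alpha>. \<alpha> \<in> A \<Longrightarrow> K \<alpha> \<in> I"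
  shows "(\<Sum>\<alpha>\<in>A. \<Sum>\<beta>\<in>A. w \<alpha> * w \<beta> * word_weight h i (J \<alpha>) (K \<alpha>) (J \<beta>) (K \<beta>)) \<ge> 0"
proof -
  \<comment> \<open>\<open>B\<close> is the quadratic form of a kernel in the weights,
    \<open>Z\<close> a linear form. On the kernels \<open>pr\<close>, \<open>xs\<close> and
    \<open>xys\<close> below, \<open>B\<close> splits into products of values of
    \<open>Z\<close>.\<close>
  define B where "B F = (\<Sum>\<alpha>\<in>A. \<Sum>\<beta>\<in>A. w \<alpha> * w \<beta> * F (J \<alpha>) (K \<alpha>) (J \<beta>) (K \<beta>))" for F :: "'a \<Rightarrow> 'a \<Rightarrow> 'a \<Rightarrow> 'a \<Rightarrow> real"
  define Z where "Z f = (\<Sum>\<alpha>\<in>A. w \<alpha> * f (J \<alpha>) (K \<alpha>))" for f :: "'a \<Rightarrow> 'a \<Rightarrow> real"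
  define pr :: "('a \<Rightarrow> 'a \<Rightarrow> real) \<Rightarrow> ('a \<Rightarrow> 'a \<Rightarrow> real) \<Rightarrow> 'a \<Rightarrow> 'a \<Rightarrow> 'a \<Rightarrow> 'a \<Rightarrow> real"
    where "pr f g j k l m = f j k * g l m" for f g j k l m
  define xs :: "('a \<Rightarrow> 'a \<Rightarrow> 'a \<Rightarrow> real) \<Rightarrow> ('a \<Rightarrow> 'a \<Rightarrow> 'a \<Rightarrow> real) \<Rightarrow> 'a \<Rightarrow> 'a \<Rightarrow> 'a \<Rightarrow> 'a \<Rightarrow> real"
    where "xs f g j k l m = (\<Sum>x\<in>I. f x j k * g x l m)" for f g j k l m
  define xys :: "('a \<Rightarrow> 'a \<Rightarrow> 'a \<Rightarrow> 'a \<Rightarrow> real) \<Rightarrow> 'a \<Rightarrow> 'a \<Rightarrow> 'a \<Rightarrow> 'a \<Rightarrow> real"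
    where "xys f j k l m = (\<Sum>x\<in>I. \<Sum>y\<in>I. f x y j k * f x y l m)" for f j k l m
  \<comment> \<open>The quantities of \<open>centered_form_nonneg\<close> for a single symmetrized
    matrix unit at \<open>(j, k)\<close>; \<open>Z\<close> extends them linearly to the matrix in
    question.\<close>
  define a s D R where "a j k = \<delta> i j * \<delta> j k" and "s j k = (\<delta> i j + \<delta> i k) / 2"
    and "D j k = \<delta> j k" and "R j k = (1::real)" for j k :: 'a
  define r d b where "r x j k = (\<delta> x j + \<delta> x k) / 2" and "d x j k = \<delta> x j * \<delta> j k"
    and "b x j k = (\<delta> i j * \<delta> x k + \<delta> i k * \<delta> x j) / 2" for x j k :: 'a
  define c where "c x y j k = (\<delta> x j * \<delta> y k + \<delta> x k * \<delta> y j) / 2" for x y j k :: 'a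
  have B_add: "B (\<lambda>j k l m. F j k l m + G j k l m) = B F + B G" for F G
    by (simp add: B_def ring_distribs sum.distrib)
  have B_cmult: "B (\<lambda>j k l m. t * F j k l m) = t * B F" for F t
    by (simp add: B_def sum_distrib_left mult_ac)
  have B_cong: "B F = B G"
    if "\<And>j k l m. j \<in> I \<Longrightarrow> k \<in> I \<Longrightarrow> l \<in> I \<Longrightarrow> m \<in> I \<Longrightarrow> F j k l m = G j k l m" for F G
    unfolding B_def by (intro sum.cong refl) (simp add: that JK)
  have B_pr: "B (pr f g) = Z f * Z g" for f g
    by (simp add: B_def pr_def Z_def sum_product mult_ac)
  have B_sum: "B (\<lambda>j k l m. \<Sum>x\<in>I. F x j k l m) = (\<Sum>x\<in>I. B (F x))" for F :: "'a \<Rightarrow> 'a \<Rightarrow> 'a \<Rightarrow> 'a \<Rightarrow> 'a \<Rightarrow> real"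
    unfolding B_def sum_distrib_left
    by (subst (2) sum.swap, subst sum.swap) (rule refl)
  have B_xs: "B (xs f g) = (\<Sum>x\<in>I. Z (f x) * Z (g x))" for f g
  proof -
    have "xs f g = (\<lambda>j k l m. \<Sum>x\<in>I. pr (f x) (g x) j k l m)" by (intro ext) (simp add: xs_def pr_def)
    then show ?thesis by (simp only: B_sum B_pr)
  qed
  have B_xys: "B (xys f) = (\<Sum>x\<in>I. \<Sum>y\<in>I. Z (f x y) * Z (f x y))" for f
  proof -
    have "xys f = (\<lambda>j k l m. \<Sum>x\<in>I. \<Sum>y\<in>I. pr (f x y) (f x y) j k l m)" by (intro ext) (simp add: xys_def pr_def)
    then show ?thesis by (simp only: B_sum B_pr)
  qed
  have Z_sum: "(\<Sum>x\<in>I. Z (f x)) = Z g"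
    if "\<And>j k. j \<in> I \<Longrightarrow> k \<in> I \<Longrightarrow> (\<Sum>x\<in>I. f x j k) = g j k" for f g
    unfolding Z_def by (subst sum.swap) (simp add: sum_distrib_left[symmetric] that JK)
  note sums = sum.distrib sum_divide_distrib[symmetric] sum_distrib_left[symmetric] sum_distrib_right[symmetric]
    sum_\<delta>[OF I(1)] sum_\<delta>_mult[OF I(1)] sum_\<delta>_mult'[OF I(1)]
  have xs_r: "xs r g j k l m = (g j l m + g k l m) / 2" and xs_d: "xs d g j k l m = \<delta> j k * g j l m"
    and xs_b: "xs b g j k l m = (\<delta> i j * g k l m + \<delta> i k * g j l m) / 2"
    if "j \<in> I" "k \<in> I" for g j k l m
  proof -
    have "xs r g j k l m = (\<Sum>x\<in>I. \<delta> x j * (g x l m / 2)) + (\<Sum>x\<in>I. \<delta> x k * (g x l m / 2))"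
      unfolding xs_def r_def sum.distrib[symmetric] by (intro sum.cong refl) (simp add: field_simps)
    then show "xs r g j k l m = (g j l m + g k l m) / 2"
      by (simp only: sum_\<delta>_mult[OF I(1)] that) simp
    have "xs d g j k l m = (\<Sum>x\<in>I. \<delta> x j * (\<delta> j k * g x l m))"
      unfolding xs_def d_def by (simp add: mult.assoc)
    then show "xs d g j k l m = \<delta> j k * g j l m"
      by (simp only: sum_\<delta>_mult[OF I(1)] that)
    have "xs b g j k l m = (\<Sum>x\<in>I. \<delta> x k * (\<delta> i j * g x l m / 2)) + (\<Sum>x\<in>I. \<delta> x j * (\<delta> i k * g x l m / 2))"
      unfolding xs_def b_def sum.distrib[symmetric] by (intro sum.cong refl) (simp add: field_simps)
    then show "xs b g j k l m = (\<delta> i j * g k l m + \<delta> i k * g j l m) / 2"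
      by (simp only: sum_\<delta>_mult[OF I(1)] that) simp
  qed
  have xys_c: "xys c j k l m = (c j k l m + c k j l m) / 2" if "j \<in> I" "k \<in> I" for j k l m
  proof -
    have "(\<Sum>y\<in>I. c x y j k * c x y l m) = \<delta> x j * (c x k l m / 2) + \<delta> x k * (c x j l m / 2)" for x
    proof -
      have "(\<Sum>y\<in>I. c x y j k * c x y l m) =
          (\<Sum>y\<in>I. \<delta> y k * (\<delta> x j * (c x y l m / 2))) + (\<Sum>y\<in>I. \<delta> y j * (\<delta> x k * (c x y l m / 2)))"
        unfolding sum.distrib[symmetric]
        by (intro sum.cong refl) (simp add: c_def[of _ _ j k] field_simps)
      then show ?thesis by (simp only: sum_\<delta>_mult[OF I(1)] that)
    qed
    then show ?thesis
      unfolding xys_def by (simp only: sum.distrib sum_\<delta>_mult[OF I(1)] that) simp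
  qed
  have collapse: "xs r r j k l m = (\<delta> j l + \<delta> j m + \<delta> k l + \<delta> k m) / 4"
    "xs d r j k l m = \<delta> j k * (\<delta> j l + \<delta> j m) / 2"
    "xs r d j k l m = \<delta> l m * (\<delta> j l + \<delta> k l) / 2"
    "xs d d j k l m = \<delta> j k * \<delta> j l * \<delta> l m"
    "xys c j k l m = (\<delta> j l * \<delta> k m + \<delta> j m * \<delta> k l) / 2"
    "xs r b j k l m = (\<delta> i l * (\<delta> j m + \<delta> k m) + \<delta> i m * (\<delta> j l + \<delta> k l)) / 4"
    "xs b r j k l m = (\<delta> i j * (\<delta> k l + \<delta> k m) + \<delta> i k * (\<delta> j l + \<delta> j m)) / 4"
    "xs b b j k l m = (\<delta> i j * \<delta> i l * \<delta> k m + \<delta> i j * \<delta> i m * \<delta> k l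
      + \<delta> i k * \<delta> i l * \<delta> j m + \<delta> i k * \<delta> i m * \<delta> j l) / 4"
    "xs d b j k l m = \<delta> j k * (\<delta> i l * \<delta> j m + \<delta> i m * \<delta> j l) / 2"
    "xs b d j k l m = \<delta> l m * (\<delta> i j * \<delta> k l + \<delta> i k * \<delta> j l) / 2"
    if "j \<in> I" "k \<in> I" "l \<in> I" "m \<in> I" for j k l m
    using that by (simp_all add: xs_r xs_d xs_b xys_c) (simp_all add: r_def d_def b_def c_def field_simps)
  \<comment> \<open>A product of two different quantities occurs in both orders, each with half of
    its coefficient in \<open>centered_form_nonneg\<close>; \<open>B\<close> does not distinguish
    the two orders.\<close>
  have "B (word_weight h i) = B (\<lambda>j k l m. 1243 * h^5 * pr R R j k l m
     + 168 * h^4 * (2 * pr s R j k l m + 2 * pr R s j k l m + pr D R j k l m + pr R D j k l m + 4 * xs r r j k l m)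
     + 101 * h^3 * (pr a R j k l m + pr R a j k l m + 4 * pr s s j k l m + 2 * xs d r j k l m + 2 * xs r d j k l m)
     + 17 * h^3 * (pr D D j k l m + 2 * xys c j k l m + 2 * pr s D j k l m + 2 * pr D s j k l m
         + 4 * xs r b j k l m + 4 * xs b r j k l m)
     + 57 * h^2 * (xs d d j k l m + 2 * pr a s j k l m + 2 * pr s a j k l m)
     + 14 * h^2 * (pr a D j k l m + pr D a j k l m + 4 * xs b b j k l m + 2 * xs d b j k l m + 2 * xs b d j k l m)
     + 29 * h * pr a a j k l m)"
  proof (rule B_cong)
    fix j k l m assume jklm: "j \<in> I" "k \<in> I" "l \<in> I" "m \<in> I"
    show "word_weight h i j k l m = 1243 * h^5 * pr R R j k l m
     + 168 * h^4 * (2 * pr s R j k l m + 2 * pr R s j k l m + pr D R j k l m + pr R D j k l m + 4 * xs r r j k l m)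
     + 101 * h^3 * (pr a R j k l m + pr R a j k l m + 4 * pr s s j k l m + 2 * xs d r j k l m + 2 * xs r d j k l m)
     + 17 * h^3 * (pr D D j k l m + 2 * xys c j k l m + 2 * pr s D j k l m + 2 * pr D s j k l m
         + 4 * xs r b j k l m + 4 * xs b r j k l m)
     + 57 * h^2 * (xs d d j k l m + 2 * pr a s j k l m + 2 * pr s a j k l m)
     + 14 * h^2 * (pr a D j k l m + pr D a j k l m + 4 * xs b b j k l m + 2 * xs d b j k l m + 2 * xs b d j k l m)
     + 29 * h * pr a a j k l m"
      unfolding collapse[OF jklm] pr_def a_def s_def D_def R_def word_weight_def symmetrized_sums
      by (simp add: field_simps) (auto simp: \<delta>_def)
  qed
  also have "\<dots> = 1243 * h^5 * (Z R * Z R)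
     + 168 * h^4 * (4 * (Z s * Z R) + 2 * (Z D * Z R) + 4 * (\<Sum>x\<in>I. Z (r x) * Z (r x)))
     + 101 * h^3 * (2 * (Z a * Z R) + 4 * (Z s * Z s) + 4 * (\<Sum>x\<in>I. Z (d x) * Z (r x)))
     + 17 * h^3 * (Z D * Z D + 2 * (\<Sum>x\<in>I. \<Sum>y\<in>I. Z (c x y) * Z (c x y)) + 4 * (Z s * Z D)
         + 8 * (\<Sum>x\<in>I. Z (r x) * Z (b x)))
     + 57 * h^2 * ((\<Sum>x\<in>I. Z (d x) * Z (d x)) + 4 * (Z a * Z s))
     + 14 * h^2 * (2 * (Z a * Z D) + 4 * (\<Sum>x\<in>I. Z (b x) * Z (b x)) + 4 * (\<Sum>x\<in>I. Z (d x) * Z (b x)))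
     + 29 * h * (Z a * Z a)"
    unfolding B_add B_cmult B_pr B_xs B_xys by (simp add: algebra_simps)
  also have "\<dots> \<ge> 0"
  proof (rule centered_form_nonneg[OF I])
    show "(\<Sum>x\<in>I. Z (r x)) = Z R" "(\<Sum>x\<in>I. Z (d x)) = Z D" "(\<Sum>x\<in>I. Z (b x)) = Z s"
      by (rule Z_sum; simp add: r_def R_def d_def D_def b_def s_def sums)+
    show "(\<Sum>y\<in>I. Z (c x y)) = Z (r x)" if "x \<in> I" for x
      by (rule Z_sum) (simp add: r_def c_def sums)
    show "(\<Sum>x\<in>I. Z (c x y)) = Z (r y)" if "y \<in> I" for y
      by (rule Z_sum) (simp add: r_def c_def sums)
  qed
  finally show ?thesis unfolding B_def .
qed

text \<open>With three distinct fixed letters the kernel involves only the diagonal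
  \<open>\<delta> l m\<close> and four linear forms. Cauchy-Schwarz replaces the diagonal by the
  square of the total weight, which leaves a quadratic form in four variables.\<close>

lemma word_weight_kernel_three:
  fixes w :: "'b \<Rightarrow> real" and L :: "'b \<Rightarrow> 'a" and I :: "'a set"
  assumes I: "finite I" "h * real (card I) = 1" "h > 0" and ijk: "i \<noteq> j" "i \<noteq> k" "j \<noteq> k"
    and L: "\<And>\<alpha>. \<alpha> \<in> A \<Longrightarrow> L \<alpha> \<in> I"
  shows "(\<Sum>\<alpha>\<in>A. \<Sum>\<beta>\<in>A. w \<alpha> * w \<beta> * word_weight h i j k (L \<alpha>) (L \<beta>)) \<ge> 0"
proof -
  define Z where "Z f = (\<Sum>\<alpha>\<in>A. w \<alpha> * f (L \<alpha>))" for f :: "'a \<Rightarrow> real"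
  define B where "B F = (\<Sum>\<alpha>\<in>A. \<Sum>\<beta>\<in>A. w \<alpha> * w \<beta> * F (L \<alpha>) (L \<beta>))" for F :: "'a \<Rightarrow> 'a \<Rightarrow> real"
  define pr :: "('a \<Rightarrow> real) \<Rightarrow> ('a \<Rightarrow> real) \<Rightarrow> 'a \<Rightarrow> 'a \<Rightarrow> real"
    where "pr f g l m = f l * g m" for f g l m
  have B_add: "B (\<lambda>l m. F l m + G l m) = B F + B G" for F G
    by (simp add: B_def ring_distribs sum.distrib)
  have B_cmult: "B (\<lambda>l m. t * F l m) = t * B F" for F t
    by (simp add: B_def sum_distrib_left mult_ac)
  have B_pr: "B (pr f g) = Z f * Z g" for f g
    by (simp add: B_def pr_def Z_def sum_product mult_ac)
  have B_\<delta>: "B \<delta> = (\<Sum>x\<in>I. Z (\<delta> x) * Z (\<delta> x))"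
  proof -
    have "B \<delta> = B (\<lambda>l m. \<Sum>x\<in>I. pr (\<delta> x) (\<delta> x) l m)"
      unfolding B_def pr_def by (intro sum.cong refl) (simp add: sum_\<delta>_mult[OF I(1)] L)
    also have "\<dots> = (\<Sum>x\<in>I. B (pr (\<delta> x) (\<delta> x)))"
      unfolding B_def sum_distrib_left by (subst (2) sum.swap, subst sum.swap) (rule refl)
    finally show ?thesis by (simp only: B_pr)
  qed
  let ?o = "\<lambda>_::'a. 1::real" and ?R = "Z (\<lambda>_. 1)"
  let ?x = "Z (\<delta> i)" and ?y = "Z (\<delta> j)" and ?z = "Z (\<delta> k)"
  have "word_weight h i j k = (\<lambda>l m. 1243 * h^5 * pr ?o ?o l m
      + 168 * h^4 * (\<delta> l m + pr (\<delta> i) ?o l m + pr (\<delta> j) ?o l m + pr (\<delta> k) ?o l m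
        + pr ?o (\<delta> i) l m + pr ?o (\<delta> j) l m + pr ?o (\<delta> k) l m)
      + 101 * h^3 * (pr (\<delta> i) (\<delta> i) l m + pr (\<delta> j) (\<delta> j) l m + pr (\<delta> k) (\<delta> k) l m)
      + 17 * h^3 * (pr (\<delta> i) (\<delta> j) l m + pr (\<delta> j) (\<delta> i) l m + pr (\<delta> i) (\<delta> k) l m
        + pr (\<delta> k) (\<delta> i) l m + pr (\<delta> j) (\<delta> k) l m + pr (\<delta> k) (\<delta> j) l m))"
  proof (intro ext)
    fix l m :: 'a
    have z: "\<delta> i j = 0" "\<delta> i k = 0" "\<delta> j k = 0" using ijk by (simp_all add: \<delta>_def)
    have sq: "\<delta> p l * \<delta> l m = \<delta> p l * \<delta> p m" for p by (simp add: \<delta>_def)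
    show "word_weight h i j k l m = 1243 * h^5 * pr ?o ?o l m
      + 168 * h^4 * (\<delta> l m + pr (\<delta> i) ?o l m + pr (\<delta> j) ?o l m + pr (\<delta> k) ?o l m
        + pr ?o (\<delta> i) l m + pr ?o (\<delta> j) l m + pr ?o (\<delta> k) l m)
      + 101 * h^3 * (pr (\<delta> i) (\<delta> i) l m + pr (\<delta> j) (\<delta> j) l m + pr (\<delta> k) (\<delta> k) l m)
      + 17 * h^3 * (pr (\<delta> i) (\<delta> j) l m + pr (\<delta> j) (\<delta> i) l m + pr (\<delta> i) (\<delta> k) l m
        + pr (\<delta> k) (\<delta> i) l m + pr (\<delta> j) (\<delta> k) l m + pr (\<delta> k) (\<delta> j) l m)"
      by (simp add: word_weight_def z sq pr_def) (simp add: algebra_simps)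
  qed
  then have "B (word_weight h i j k) = 1243 * h^5 * (?R * ?R)
      + 168 * h^4 * ((\<Sum>x\<in>I. Z (\<delta> x) * Z (\<delta> x)) + 2 * ?R * (?x + ?y + ?z))
      + 101 * h^3 * (?x * ?x + ?y * ?y + ?z * ?z) + 34 * h^3 * (?x * ?y + ?x * ?z + ?y * ?z)"
    by (simp only: B_add B_cmult B_pr B_\<delta>) (simp add: algebra_simps)
  moreover have "h * (?R * ?R) \<le> (\<Sum>x\<in>I. Z (\<delta> x) * Z (\<delta> x))"
  proof -
    have R: "(\<Sum>x\<in>I. Z (\<delta> x)) = ?R"
      unfolding Z_def by (subst sum.swap) (simp add: sum_distrib_left[symmetric] sum_\<delta>[OF I(1)] L)
    have "0 \<le> (\<Sum>x\<in>I. (Z (\<delta> x) - h * ?R) * (Z (\<delta> x) - h * ?R))" by (intro sum_nonneg) simp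
    then show ?thesis using sum_centered[OF I(2), of "\<lambda>x. Z (\<delta> x)" "\<lambda>x. Z (\<delta> x)"] by (simp add: R)
  qed
  then have "168 * h^4 * (h * (?R * ?R)) \<le> 168 * h^4 * (\<Sum>x\<in>I. Z (\<delta> x) * Z (\<delta> x))"
    using I(3) by (intro mult_left_mono) simp_all
  \<comment> \<open>The squares of differences carry the weight 28 because
    \<open>101 = 45 + 2 * 28\<close> and \<open>34 = 2 * (45 - 28)\<close>. Completing the square
    with the mixed coefficient 336 then costs \<open>168\<^sup>2 / 45\<close>, less than the
    available \<open>1411 = 1243 + 168\<close>.\<close>
  moreover have "0 \<le> h^3 * (45 * (?x + ?y + ?z + 168 / 45 * (h * ?R))\<^sup>2 + (1411 - 28224 / 45) * (h * ?R)\<^sup>2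
      + 28 * ((?x - ?y)\<^sup>2 + (?x - ?z)\<^sup>2 + (?y - ?z)\<^sup>2))"
    using I(3) by (intro mult_nonneg_nonneg add_nonneg_nonneg) simp_all
  moreover have "\<dots> = 1243 * h^5 * (?R * ?R) + 168 * h^4 * (h * (?R * ?R)) + 336 * h^4 * ?R * (?x + ?y + ?z)
      + 101 * h^3 * (?x * ?x + ?y * ?y + ?z * ?z) + 34 * h^3 * (?x * ?y + ?x * ?z + ?y * ?z)"
    by (simp add: power2_eq_square eval_nat_numeral field_simps)
  ultimately have "B (word_weight h i j k) \<ge> 0" by (simp add: algebra_simps)
  then show ?thesis by (simp add: B_def)
qed

text \<open>Settles five odd variables, where only one quintic monomial remains.\<close>

lemma word_weight_nonneg: "h \<ge> 0 \<Longrightarrow> word_weight h i j k l m \<ge> 0"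
  unfolding word_weight_def \<delta>_def by (intro add_nonneg_nonneg mult_nonneg_nonneg) simp_all

section \<open>The functional is nonnegative on squares of quintic forms\<close>

definition odd_support :: "monom \<Rightarrow> nat set" where
  "odd_support m = {i. odd (Poly_Mapping.lookup m i)}"

lemma finite_odd_support: "finite (odd_support m)"
  by (rule finite_subset[OF _ finite_keys[of m]]) (auto simp: odd_support_def in_keys_iff intro: odd_pos)

lemma odd_support_subset_keys: "odd_support m \<subseteq> Poly_Mapping.keys m"
  by (auto simp: odd_support_def in_keys_iff intro: odd_pos)

abbreviation lin :: "nat \<Rightarrow> monom" where
  "lin i \<equiv> Poly_Mapping.single i 1"

lemma sq_eq: "sq i = lin i + lin i"
  by (metis single_add one_add_one)

lemma mdeg_sum: "mdeg (sum F S) = (\<Sum>s\<in>S. mdeg (F s))"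
  by (induction S rule: infinite_finite_induct) (simp_all add: mdeg_add)

lemma odd_support_decomp:
  obtains u where "m = (\<Sum>i\<in>odd_support m. lin i) + (u + u)" "Poly_Mapping.keys u \<subseteq> Poly_Mapping.keys m"
proof
  let ?u = "Poly_Mapping.map (\<lambda>x. x div 2) m"
  have u: "Poly_Mapping.lookup ?u x = Poly_Mapping.lookup m x div 2" for x
    by (simp add: map.rep_eq when_def)
  have odd: "Poly_Mapping.lookup (\<Sum>i\<in>odd_support m. lin i) x = Poly_Mapping.lookup m x mod 2" for x
    by (simp add: lookup_sum lookup_single when_def finite_odd_support)
      (auto simp: odd_support_def odd_iff_mod_2_eq_one even_iff_mod_2_eq_zero)
  show "m = (\<Sum>i\<in>odd_support m. lin i) + (?u + ?u)"
  proof (rule poly_mapping_eqI)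
    fix x
    show "Poly_Mapping.lookup m x = Poly_Mapping.lookup ((\<Sum>i\<in>odd_support m. lin i) + (?u + ?u)) x"
      unfolding lookup_add u odd by presburger
  qed
  show "Poly_Mapping.keys ?u \<subseteq> Poly_Mapping.keys m"
    by (auto simp: in_keys_iff u)
qed

lemma mdeg_SucE:
  assumes "mdeg u = Suc k"
  obtains j v where "j \<in> Poly_Mapping.keys u" "u = lin j + v" "mdeg v = k" "Poly_Mapping.keys v \<subseteq> Poly_Mapping.keys u"
proof -
  from assms have "Poly_Mapping.keys u \<noteq> {}" by (auto simp: mdeg_def)
  then obtain j where j: "j \<in> Poly_Mapping.keys u" by blast
  have u: "u = lin j + (u - lin j)"
    by (rule poly_mapping_eqI) (use j in \<open>auto simp: lookup_add lookup_minus lookup_single when_def in_keys_iff\<close>)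
  have "mdeg u = 1 + mdeg (u - lin j)" by (subst u) (simp only: mdeg_add mdeg_single)
  then have "mdeg (u - lin j) = k" using assms by simp
  moreover have "Poly_Mapping.keys (u - lin j) \<subseteq> Poly_Mapping.keys u"
    by (auto simp: in_keys_iff lookup_minus)
  ultimately show ?thesis using that j u by blast
qed

lemma mdeg_eq_0: "mdeg u = 0 \<Longrightarrow> u = 0"
  by (auto simp: mdeg_def in_keys_iff intro!: poly_mapping_eqI)

text \<open>Block diagonality: \<open>M\<close> couples only indices in the same fibre of
  \<open>f\<close>, so positivity may be checked fibre by fibre. The fibres used later are those of
  \<open>odd_support\<close>.\<close>

lemma sum_square_group:
  fixes w :: "'b \<Rightarrow> real"
  assumes "finite K" and zero: "\<And>a b. a \<in> K \<Longrightarrow> b \<in> K \<Longrightarrow> f a \<noteq> f b \<Longrightarrow> M a b = 0"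
    and nonneg: "\<And>S. S \<in> f ` K \<Longrightarrow> (\<Sum>a\<in>{a\<in>K. f a = S}. \<Sum>b\<in>{a\<in>K. f a = S}. w a * w b * M a b) \<ge> 0"
  shows "(\<Sum>a\<in>K. \<Sum>b\<in>K. w a * w b * M a b) \<ge> 0"
proof -
  have "(\<Sum>a\<in>K. \<Sum>b\<in>K. w a * w b * M a b) = (\<Sum>a\<in>K. \<Sum>b\<in>{b\<in>K. f b = f a}. w a * w b * M a b)"
    by (intro sum.cong refl sum.mono_neutral_right) (auto simp: assms(1) intro: zero)
  also have "\<dots> = (\<Sum>S\<in>f ` K. \<Sum>a\<in>{a\<in>K. f a = S}. \<Sum>b\<in>{b\<in>K. f b = f a}. w a * w b * M a b)"
    by (rule sum.image_gen[OF assms(1)])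
  also have "\<dots> = (\<Sum>S\<in>f ` K. \<Sum>a\<in>{a\<in>K. f a = S}. \<Sum>b\<in>{a\<in>K. f a = S}. w a * w b * M a b)"
    by (intro sum.cong refl) auto
  also have "\<dots> \<ge> 0" by (intro sum_nonneg nonneg)
  finally show ?thesis .
qed

lemma weight_eq_0:
  assumes "odd_support a \<noteq> odd_support b"
  shows "weight h (a + b) = 0"
proof -
  from assms obtain i where "i \<in> odd_support a \<longleftrightarrow> i \<notin> odd_support b" by blast
  then have "odd (Poly_Mapping.lookup (a + b) i)" by (auto simp: odd_support_def lookup_add)
  then show ?thesis by (auto simp: weight_def)
qed

text \<open>Each monomial of the block is the product of the variables in \<open>S\<close> times the
  square of a monomial of degree \<open>(5 - card S) / 2\<close>. In a sum of two of them the
  variables of \<open>S\<close> become squares, so \<open>weight_word\<close> applies.\<close>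

lemma weight_kernel_nonneg:
  fixes w :: "monom \<Rightarrow> real" and A :: "monom set"
  assumes n: "n > 0" and A: "finite A" "A \<noteq> {}"
    and deg: "\<And>m. m \<in> A \<Longrightarrow> mdeg m = 5" and vars: "\<And>m. m \<in> A \<Longrightarrow> Poly_Mapping.keys m \<subseteq> {1..n}"
    and S: "\<And>m. m \<in> A \<Longrightarrow> odd_support m = S"
  shows "(\<Sum>a\<in>A. \<Sum>b\<in>A. w a * w b * weight (1 / real n) (a + b)) \<ge> 0"
proof -
  let ?h = "1 / real n" and ?I = "{1..n}"
  have h: "finite ?I" "?h * real (card ?I) = 1" "?h > 0" using n by auto
  have dec: "\<exists>u. m = (\<Sum>i\<in>S. lin i) + (u + u) \<and> Poly_Mapping.keys u \<subseteq> ?I \<and> card S + 2 * mdeg u = 5"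
    if m: "m \<in> A" for m
  proof -
    obtain u where u: "m = (\<Sum>i\<in>S. lin i) + (u + u)" "Poly_Mapping.keys u \<subseteq> Poly_Mapping.keys m"
      using odd_support_decomp[of m] S[OF m] by metis
    have "mdeg m = card S + 2 * mdeg u"
      by (subst u(1)) (simp add: mdeg_add mdeg_sum)
    then show ?thesis using u vars[OF m] deg[OF m] by auto
  qed
  obtain m0 where m0: "m0 \<in> A" using A by blast
  have SI: "S \<subseteq> ?I" using odd_support_subset_keys[of m0] vars[OF m0] S[OF m0] by auto
  have "card S + 2 * d = 5 \<Longrightarrow> card S = 1 \<and> d = 2 \<or> card S = 3 \<and> d = 1 \<or> card S = 5 \<and> d = 0" for d :: nat
    by presburger
  with dec[OF m0] consider "card S = 1" | "card S = 3" | "card S = 5" by blast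
  then show ?thesis
  proof cases
    case 1
    then obtain i where i: "S = {i}" by (auto simp: card_1_singleton_iff)
    have "\<exists>j k. j \<in> ?I \<and> k \<in> ?I \<and> m = lin i + (sq j + sq k)" if m: "m \<in> A" for m
    proof -
      from dec[OF m] obtain u where u: "m = lin i + (u + u)" "Poly_Mapping.keys u \<subseteq> ?I" "mdeg u = 2"
        by (auto simp: i)
      from u(3) obtain j v where j: "j \<in> Poly_Mapping.keys u" "u = lin j + v" "mdeg v = 1"
        "Poly_Mapping.keys v \<subseteq> Poly_Mapping.keys u" by (auto simp: numeral_2_eq_2 elim: mdeg_SucE)
      from j(3) obtain k v' where k: "k \<in> Poly_Mapping.keys v" "v = lin k + v'" "mdeg v' = 0"
        by (auto elim: mdeg_SucE)
      have "m = lin i + (sq j + sq k)"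
        unfolding u(1) j(2) k(2) mdeg_eq_0[OF k(3)] sq_eq by (simp only: add_ac add_0)
      then show ?thesis using j k u(2) by blast
    qed
    then obtain J K where JK: "\<And>m. m \<in> A \<Longrightarrow> J m \<in> ?I" "\<And>m. m \<in> A \<Longrightarrow> K m \<in> ?I"
      "\<And>m. m \<in> A \<Longrightarrow> m = lin i + (sq (J m) + sq (K m))" by metis
    have "weight ?h (a + b) = word_weight ?h i (J a) (K a) (J b) (K b)" if "a \<in> A" "b \<in> A" for a b
    proof -
      have "a + b = (lin i + (sq (J a) + sq (K a))) + (lin i + (sq (J b) + sq (K b)))"
        using JK(3) that by metis
      also have "\<dots> = sq i + sq (J a) + sq (K a) + sq (J b) + sq (K b)"
        unfolding sq_eq[of i] by (simp only: add_ac)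
      finally show ?thesis by (simp only: weight_word)
    qed
    then have "(\<Sum>a\<in>A. \<Sum>b\<in>A. w a * w b * weight ?h (a + b)) =
        (\<Sum>a\<in>A. \<Sum>b\<in>A. w a * w b * word_weight ?h i (J a) (K a) (J b) (K b))"
      by (intro sum.cong refl) simp
    also have "\<dots> \<ge> 0"
      by (rule word_weight_kernel_one[OF h]) (use i SI JK in auto)
    finally show ?thesis .
  next
    case 2
    then obtain i j k where S3: "S = {i, j, k}" and ijk: "i \<noteq> j" "i \<noteq> k" "j \<noteq> k"
      by (auto simp: card_3_iff)
    have sumS: "(\<Sum>i\<in>S. lin i) = lin i + lin j + lin k" using ijk by (simp add: S3 add.assoc)
    have "\<exists>l. l \<in> ?I \<and> m = lin i + lin j + lin k + sq l" if m: "m \<in> A" for m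
    proof -
      from dec[OF m] obtain u where "m = (\<Sum>i\<in>S. lin i) + (u + u)" "Poly_Mapping.keys u \<subseteq> ?I" "card S + 2 * mdeg u = 5"
        by blast
      then have u: "m = lin i + lin j + lin k + (u + u)" "Poly_Mapping.keys u \<subseteq> ?I" "mdeg u = 1"
        using 2 unfolding sumS by simp_all
      from u(3) obtain l v where l: "l \<in> Poly_Mapping.keys u" "u = lin l + v" "mdeg v = 0"
        by (auto elim: mdeg_SucE)
      have "m = lin i + lin j + lin k + sq l"
        unfolding u(1) l(2) mdeg_eq_0[OF l(3)] sq_eq by (simp only: add_ac add_0)
      then show ?thesis using l u(2) by blast
    qed
    then obtain L where L: "\<And>m. m \<in> A \<Longrightarrow> L m \<in> ?I"
      "\<And>m. m \<in> A \<Longrightarrow> m = lin i + lin j + lin k + sq (L m)" by metis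
    have "weight ?h (a + b) = word_weight ?h i j k (L a) (L b)" if "a \<in> A" "b \<in> A" for a b
    proof -
      have "a + b = (lin i + lin j + lin k + sq (L a)) + (lin i + lin j + lin k + sq (L b))"
        using L(2) that by metis
      also have "\<dots> = sq i + sq j + sq k + sq (L a) + sq (L b)"
        unfolding sq_eq[of i] sq_eq[of j] sq_eq[of k] by (simp only: add_ac)
      finally show ?thesis by (simp only: weight_word)
    qed
    then have "(\<Sum>a\<in>A. \<Sum>b\<in>A. w a * w b * weight ?h (a + b)) =
        (\<Sum>a\<in>A. \<Sum>b\<in>A. w a * w b * word_weight ?h i j k (L a) (L b))"
      by (intro sum.cong refl) simp
    also have "\<dots> \<ge> 0"
      by (rule word_weight_kernel_three[OF h ijk]) (use L in auto)
    finally show ?thesis .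
  next
    case 3
    then have "card S = Suc (Suc (Suc (Suc (Suc 0))))" by simp
    then obtain i j k l p where S5: "S = {i, j, k, l, p}"
      and ne: "i \<notin> {j, k, l, p}" "j \<notin> {k, l, p}" "k \<notin> {l, p}" "l \<noteq> p"
      unfolding card_Suc_eq by blast
    have sumS: "(\<Sum>i\<in>S. lin i) = lin i + lin j + lin k + lin l + lin p"
      using ne by (simp add: S5 add.assoc)
    have m: "m = lin i + lin j + lin k + lin l + lin p" if m: "m \<in> A" for m
    proof -
      from dec[OF m] obtain u where "m = (\<Sum>i\<in>S. lin i) + (u + u)" "card S + 2 * mdeg u = 5"
        by blast
      then have "m = lin i + lin j + lin k + lin l + lin p + (u + u)" "mdeg u = 0"
        using 3 unfolding sumS by simp_all
      then show ?thesis using mdeg_eq_0[of u] by simp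
    qed
    then have A1: "A = {m0}" using m0 by blast
    have "m0 + m0 = (lin i + lin j + lin k + lin l + lin p) + (lin i + lin j + lin k + lin l + lin p)"
      using m[OF m0] by simp
    also have "\<dots> = sq i + sq j + sq k + sq l + sq p"
      unfolding sq_eq by (simp only: add_ac)
    finally have "weight ?h (m0 + m0) = word_weight ?h i j k l p" by (simp only: weight_word)
    then show ?thesis using word_weight_nonneg[of ?h i j k l p] by (simp add: A1)
  qed
qed

lemma weight_square_nonneg:
  assumes n: "n > 0" and q: "q \<in> poly_ring n" "form_of_degree 5 q"
  shows "lin_ext (\<lambda>c. c) (weight (1 / real n)) (q ^ 2) \<ge> 0"
proof -
  have "(\<Sum>a\<in>Poly_Mapping.keys q. \<Sum>b\<in>Poly_Mapping.keys q.
      Poly_Mapping.lookup q a * Poly_Mapping.lookup q b * weight (1 / real n) (a + b)) \<ge> 0"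
  proof (rule sum_square_group[where f = odd_support])
    fix S assume S: "S \<in> odd_support ` Poly_Mapping.keys q"
    show "(\<Sum>a\<in>{a \<in> Poly_Mapping.keys q. odd_support a = S}. \<Sum>b\<in>{a \<in> Poly_Mapping.keys q. odd_support a = S}.
      Poly_Mapping.lookup q a * Poly_Mapping.lookup q b * weight (1 / real n) (a + b)) \<ge> 0"
      by (rule weight_kernel_nonneg[where S = S, OF n]) (use S q in \<open>auto simp: poly_ring_def form_of_degree_iff\<close>)
  qed (auto intro: weight_eq_0)
  then show ?thesis by (simp add: power2_eq_square real_id.lin_ext_mult)
qed

section \<open>The functional is negative on the form\<close>

lemma lin_ext_Const_mult: "lin_ext (\<lambda>c. c) \<phi> (Const c * f) = c * lin_ext (\<lambda>c. c) \<phi> f"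
proof -
  have "Const c * f = (\<Sum>m\<in>Poly_Mapping.keys f. Poly_Mapping.single m (c * Poly_Mapping.lookup f m))"
    by (subst (1) sum_singles[symmetric]) (simp add: Const_def sum_distrib_left mult_single)
  then show ?thesis
    by (simp add: real_id.lin_ext_sum real_id.lin_ext_single) (simp add: lin_ext_def sum_distrib_left mult_ac)
qed

text \<open>An even power of a variable is a word repeating one letter, so the parts, halved,
  prescribe which positions of the word are tied together.\<close>

lemma weight_power_sums:
  defines "L h \<equiv> lin_ext (\<lambda>c. c) (weight h)"
  shows "L h (power_sum n 2 ^ 5) = (\<Sum>i=1..n. \<Sum>j=1..n. \<Sum>k=1..n. \<Sum>l=1..n. \<Sum>m=1..n. word_weight h i j k l m)"
    and "L h (power_sum n 8 * power_sum n 2) = (\<Sum>i=1..n. \<Sum>j=1..n. word_weight h i i i i j)"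
    and "L h (power_sum n 6 * power_sum n 4) = (\<Sum>i=1..n. \<Sum>j=1..n. word_weight h i i i j j)"
    and "L h (power_sum n 6 * power_sum n 2 ^ 2) = (\<Sum>i=1..n. \<Sum>j=1..n. \<Sum>k=1..n. word_weight h i i i j k)"
proof -
  have e: "Poly_Mapping.single i 8 = sq i + sq i + sq i + sq i" "Poly_Mapping.single i 6 = sq i + sq i + sq i"
    "Poly_Mapping.single i 4 = sq i + sq i" for i :: nat
    by (simp_all add: single_add[symmetric])
  note L = L_def power_sum_eq sum_product mult_single real_id.lin_ext_sum real_id.lin_ext_single
  have p5: "p ^ 5 = p * (p * (p * (p * p)))" for p :: rpoly by (simp add: eval_nat_numeral mult_ac)
  show "L h (power_sum n 2 ^ 5) = (\<Sum>i=1..n. \<Sum>j=1..n. \<Sum>k=1..n. \<Sum>l=1..n. \<Sum>m=1..n. word_weight h i j k l m)"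
    unfolding p5 power_sum_eq sum_distrib_right
    unfolding sum_distrib_left
    by (simp add: L weight_word add.assoc[symmetric])
  show "L h (power_sum n 8 * power_sum n 2) = (\<Sum>i=1..n. \<Sum>j=1..n. word_weight h i i i i j)"
    unfolding weight_word[symmetric] L e by simp
  show "L h (power_sum n 6 * power_sum n 4) = (\<Sum>i=1..n. \<Sum>j=1..n. word_weight h i i i j j)"
    unfolding weight_word[symmetric] L e by (simp add: add.assoc)
  show "L h (power_sum n 6 * power_sum n 2 ^ 2) = (\<Sum>i=1..n. \<Sum>j=1..n. \<Sum>k=1..n. word_weight h i i i j k)"
    unfolding power2_eq_square power_sum_eq e sum_distrib_right
    unfolding sum_distrib_left
    by (simp add: L weight_word add.assoc[symmetric])
qed

text \<open>The constant terms come from the set partitions coarser than the ties: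
  \<open>86 = 57 + 29\<close>, \<open>43 = 14 + 29\<close>,
  \<open>258 = 101 + 2 * 57 + 14 + 29\<close>. Without ties every set partition counts fully, so
  4642 is the sum of all 52 coefficients, with no error in \<open>h\<close>.\<close>

lemma word_weight_sums:
  fixes I :: "'a set"
  assumes I: "finite I" and h: "h * real (card I) = 1"
  shows "(\<Sum>i\<in>I. \<Sum>j\<in>I. \<Sum>k\<in>I. \<Sum>l\<in>I. \<Sum>m\<in>I. word_weight h i j k l m) = 4642"
    and "(\<Sum>i\<in>I. \<Sum>j\<in>I. word_weight h i i i i j) = 86 + 823 * h + 1818 * h^2 + 1915 * h^3"
    and "(\<Sum>i\<in>I. \<Sum>j\<in>I. word_weight h i i i j j) = 43 + 563 * h + 1785 * h^2 + 2251 * h^3"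
    and "(\<Sum>i\<in>I. \<Sum>j\<in>I. \<Sum>k\<in>I. word_weight h i i i j k) = 258 + 1560 * h + 2824 * h^2"
proof -
  have \<delta>1: "(\<Sum>x\<in>I. \<delta> x y) = 1" "(\<Sum>x\<in>I. \<delta> y x) = 1" if "y \<in> I" for y
    using sum_\<delta>[OF I that] by (simp_all add: \<delta>_commute[of y])
  show "(\<Sum>i\<in>I. \<Sum>j\<in>I. \<Sum>k\<in>I. \<Sum>l\<in>I. \<Sum>m\<in>I. word_weight h i j k l m) = 4642"
  proof -
    have "(\<Sum>i\<in>I. \<Sum>j\<in>I. \<Sum>k\<in>I. \<Sum>l\<in>I. \<Sum>m\<in>I. word_weight h i j k l m) = real (card I) * (29 * h
        + real (card I) * (425 * h^2 + real (card I) * (1265 * h^3 + real (card I) * (1680 * h^4 + real (card I) * (1243 * h^5)))))"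
      by (simp add: word_weight_def sum.distrib sum_distrib_left[symmetric] sum_distrib_right[symmetric]
          \<delta>1 mult.assoc cong: sum.cong_simp) (simp add: algebra_simps)
    also have "\<dots> = 4642" using h by algebra
    finally show ?thesis .
  qed
  have "word_weight h i i i i j = (57 * h^2 + 455 * h^3 + 1008 * h^4 + 1243 * h^5)
      + (29 * h + 368 * h^2 + 810 * h^3 + 672 * h^4) * \<delta> i j" for i j :: 'a
    by (cases "i = j") (simp_all add: word_weight_def \<delta>_def)
  then have "(\<Sum>i\<in>I. \<Sum>j\<in>I. word_weight h i i i i j) = real (card I) * (real (card I) *
      (57 * h^2 + 455 * h^3 + 1008 * h^4 + 1243 * h^5) + (29 * h + 368 * h^2 + 810 * h^3 + 672 * h^4))"
    by (simp add: sum.distrib sum_distrib_left[symmetric] \<delta>1)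
  also have "\<dots> = 86 + 823 * h + 1818 * h^2 + 1915 * h^3" using h by algebra
  finally show "(\<Sum>i\<in>I. \<Sum>j\<in>I. word_weight h i i i i j) = 86 + 823 * h + 1818 * h^2 + 1915 * h^3" .
  have "word_weight h i i i j j = (14 * h^2 + 152 * h^3 + 672 * h^4 + 1243 * h^5)
      + (29 * h + 411 * h^2 + 1113 * h^3 + 1008 * h^4) * \<delta> i j" for i j :: 'a
    by (cases "i = j") (simp_all add: word_weight_def \<delta>_def)
  then have "(\<Sum>i\<in>I. \<Sum>j\<in>I. word_weight h i i i j j) = real (card I) * (real (card I) *
      (14 * h^2 + 152 * h^3 + 672 * h^4 + 1243 * h^5) + (29 * h + 411 * h^2 + 1113 * h^3 + 1008 * h^4))"
    by (simp add: sum.distrib sum_distrib_left[symmetric] \<delta>1)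
  also have "\<dots> = 43 + 563 * h + 1785 * h^2 + 2251 * h^3" using h by algebra
  finally show "(\<Sum>i\<in>I. \<Sum>j\<in>I. word_weight h i i i j j) = 43 + 563 * h + 1785 * h^2 + 2251 * h^3" .
  \<comment> \<open>Each letter collects the set partitions by how they connect the tied triple and
    the two free positions: not at all, one free position with the triple, the free positions with
    each other only, or everything.\<close>
  define \<epsilon> \<beta> \<gamma> \<alpha> where "\<epsilon> = 101 * h^3 + 504 * h^4 + 1243 * h^5"
    and "\<beta> = 57 * h^2 + 354 * h^3 + 504 * h^4"
    and "\<gamma> = 14 * h^2 + 51 * h^3 + 168 * h^4"
    and "\<alpha> = 29 * h + 297 * h^2 + 405 * h^3"
  have "word_weight h i i i j k = \<epsilon> + \<beta> * \<delta> i j + \<beta> * \<delta> i k + \<gamma> * \<delta> j k + \<alpha> * (\<delta> i j * \<delta> j k)" for i j k :: 'a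
    unfolding \<epsilon>_def \<beta>_def \<gamma>_def \<alpha>_def
    by (cases "i = j"; cases "i = k"; cases "j = k") (simp_all add: word_weight_def \<delta>_def)
  moreover have "(\<Sum>j\<in>I. \<Sum>k\<in>I. \<delta> i j * \<delta> j k) = 1" if "i \<in> I" for i
    by (simp add: sum_distrib_left[symmetric] \<delta>1 that)
  ultimately have "(\<Sum>i\<in>I. \<Sum>j\<in>I. \<Sum>k\<in>I. word_weight h i i i j k) = real (card I) * (real (card I) * (real (card I) * \<epsilon>)
      + real (card I) * (2 * \<beta> + \<gamma>) + \<alpha>)"
    by (simp add: sum.distrib sum_distrib_left[symmetric] sum_distrib_right[symmetric] \<delta>1 algebra_simps)
  also have "\<dots> = 258 + 1560 * h + 2824 * h^2"
    unfolding \<epsilon>_def \<beta>_def \<gamma>_def \<alpha>_def using h by algebra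
  finally show "(\<Sum>i\<in>I. \<Sum>j\<in>I. \<Sum>k\<in>I. word_weight h i i i j k) = 258 + 1560 * h + 2824 * h^2" .
qed

text \<open>The last three terms of the form add up to \<open>-258\<close> in the limit, and
  \<open>4642 / 18\<close> is smaller than 258 by exactly 1/9.\<close>

lemma weight_the_form_neg:
  assumes "n \<ge> 20000"
  shows "lin_ext (\<lambda>c. c) (weight (1 / real n)) (the_form n) < 0"
proof -
  define h where "h = 1 / real n"
  have n: "h * real (card {1..n}) = 1" and h: "h > 0" "h \<le> 1 / 20000"
    using assms by (auto simp: h_def field_simps)
  note S = word_weight_sums[OF finite_atLeastAtMost n]
  have "lin_ext (\<lambda>c. c) (weight h) (the_form n) = 4642 / 18 + 3 * (86 + 823 * h + 1818 * h^2 + 1915 * h^3)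
      + 6 * (43 + 563 * h + 1785 * h^2 + 2251 * h^3) - 3 * (258 + 1560 * h + 2824 * h^2)"
    unfolding the_form_eq mult.assoc real_id.lin_ext_add real_id.lin_ext_diff lin_ext_Const_mult weight_power_sums S
    by simp
  also have "\<dots> = - 1 / 9 + h * (1167 + 7692 * h + 19251 * h^2)"
    by (simp add: algebra_simps eval_nat_numeral)
  \<comment> \<open>The bracket tends to 1167, and 2000 is a generous bound;
    \<open>2000 * h < 1 / 9\<close> holds once \<open>n > 18000\<close>, which the threshold 20000
    ensures.\<close>
  also have "\<dots> \<le> - 1 / 9 + h * 2000"
  proof -
    have "h^2 \<le> h" using h by (simp add: power2_eq_square mult_left_le)
    then have "1167 + 7692 * h + 19251 * h^2 \<le> 2000" using h by linarith
    then show ?thesis using h by simp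
  qed
  also have "\<dots> < 0" using h by simp
  finally show ?thesis by (simp add: h_def)
qed

theorem proposition5p27:
  shows "(\<forall>n. the_form n = Const (1 / 18) * power_sum n 2 ^ 5
               + Const 3 * power_sum n 8 * power_sum n 2
               + Const 6 * power_sum n 6 * power_sum n 4
               - Const 3 * power_sum n 6 * power_sum n 2 ^ 2)
       \<and> (\<forall>n. the_form n \<in> poly_ring n \<and> form_of_degree 10 (the_form n)
               \<and> symmetric_poly n (the_form n) \<and> even_poly (the_form n))
       \<and> (\<forall>n. nonneg_poly (the_form n))
       \<and> (\<exists>N. \<forall>n\<ge>N. \<not> sum_of_squares n (the_form n))"
proof (intro conjI allI)
  show "\<exists>N. \<forall>n\<ge>N. \<not> sum_of_squares n (the_form n)"
  proof (intro exI allI impI notI)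
    fix n :: nat
    \<comment> \<open>This instantiates the still open witness \<open>N\<close> with 20000.\<close>
    assume n: "n \<ge> 20000" and "sum_of_squares n (the_form n)"
    then obtain qs where qs: "set qs \<subseteq> poly_ring n" "the_form n = (\<Sum>q\<leftarrow>qs. q ^ 2)"
      by (auto simp: sum_of_squares_def)
    have "form_of_degree 5 q" if "q \<in> set qs" for q
      by (rule form_of_degree_of_sum_squares[OF _ that])
        (use form_of_degree_the_form[of n] in \<open>simp add: qs(2)\<close>)
    then have "0 \<le> lin_ext (\<lambda>c. c) (weight (1 / real n)) (q ^ 2)" if "q \<in> set qs" for q
      using n qs(1) that by (intro weight_square_nonneg) auto
    then have "0 \<le> lin_ext (\<lambda>c. c) (weight (1 / real n)) (the_form n)"
      unfolding qs(2) real_id.lin_ext_sum_list by (intro sum_list_nonneg) auto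
    with weight_the_form_neg[OF n] show False by simp
  qed
qed (rule the_form_eq the_form_in_poly_ring form_of_degree_the_form symmetric_poly_the_form
    even_poly_the_form nonneg_the_form)+

end
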